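(* Let $0<\alpha<\frac12$ and let $\mathcal{F}_1\subseteq\mathcal{F}$ be two parameter spaces. Then $$L_\alpha^*(\mathcal{F}_1,\mathcal{F})\ \ge\ \Big(\frac12-\alpha\Big)\,\omega_+\Big(\frac{z_\alpha}{\sqrt n},\mathcal{F}_1,\mathcal{F}\Big).$$
   Context: Model. One observes, for a given $n$, either the white noise model $dY(t)=f(t)\,dt+n^{-1/2}\,dW(t)$, $-\frac12\le t\le\frac12$, with $W$ standard Brownian motion, or the Gaussian sequence model $Y(i)=f(i)+n^{-1/2}z_i$, $i\in\mathcal{M}$, with $z_i$ i.i.d. standard normal and $\mathcal{M}$ a finite or countably infinite index set. The result is for either model. $P_f,E_f$ denote probability and expectation when $f$ is the truth. $\|\cdot\|_2$ is the $L_2(-\frac12,\frac12)$ norm in the white noise model and the $\ell_2(\mathcal{M})$ norm in the sequence model. A parameter space is a (nonempty) set of possible $f$, and $T$ is a linear functional to be estimated. Confidence intervals. A confidence interval $CI$ is a data-dependent interval, with length $L(CI)$. $\mathcal{I}_{\alpha,\mathcal{F}}$ is the collection of all confidence intervals with $\inf_{f\in\mathcal{F}}P_f(Tf\in CI)\ge 1-\alpha$. For a parameter space $\mathcal{G}$, $L(CI,\mathcal{G})=\sup_{f\in\mathcal{G}}E_f(L(CI))$. Set $L_\alpha^*(\mathcal{F}_1,\mathcal{F})=\inf_{CI\in\mathcal{I}_{\alpha,\mathcal{F}}}L(CI,\mathcal{F}_1)$. Between class modulus: $\omega_+(\varepsilon,\mathcal{F},\mathcal{G})=\sup\{|Tg-Tf|:\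 \|g-f\|_2\le\varepsilon,\ f\in\mathcal{F},\ g\in\mathcal{G}\}$. $z_\alpha=\Phi^{-1}(1-\alpha)$, with $\Phi$ the standard normal distribution function. *)

theory Defs
  imports "HOL-Probability.Probability"
begin

definition normal_quantile :: "real \<Rightarrow> real" where
  "normal_quantile \<alpha> = the_inv (cdf std_normal_distribution) (1 - \<alpha>)"

text \<open>
  The norms of both models are instances of the following one: \<open>\<mu>\<close> is Lebesgue measure on
  \<open>[-1/2, 1/2]\<close> in the white noise model and counting measure on the index set in the
  sequence model.
\<close>

definition square_integrable :: "'a measure \<Rightarrow> ('a \<Rightarrow> real) \<Rightarrow> bool" where
  "square_integrable \<mu> h \<longleftrightarrow> h \<in> borel_measurable \<mu> \<and> integrable \<mu> (\<lambda>x. (h x)\<^sup>2)"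

definition L2_norm :: "'a measure \<Rightarrow> ('a \<Rightarrow> real) \<Rightarrow> real" where
  "L2_norm \<mu> h = sqrt (\<integral>x. (h x)\<^sup>2 \<partial>\<mu>)"

text \<open>
  The Bochner integral of a non-integrable function is \<open>0\<close>, so \<open>\<parallel>g - f\<parallel>\<^sub>2 \<le> \<epsilon>\<close> has to include
  the square integrability of \<open>g - f\<close>. The supremum is taken in \<open>[0, \<infinity>]\<close>.
\<close>

definition between_class_modulus ::
  "'a measure \<Rightarrow> (('a \<Rightarrow> real) \<Rightarrow> real) \<Rightarrow> real \<Rightarrow> ('a \<Rightarrow> real) set \<Rightarrow> ('a \<Rightarrow> real) set \<Rightarrow> ennreal"
where
  "between_class_modulus \<mu> T \<epsilon> F G =
     Sup {ennreal \<bar>T g - T f\<bar> | f g. f \<in> F \<and> g \<in> G \<and>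
       square_integrable \<mu> (\<lambda>x. g x - f x) \<and> L2_norm \<mu> (\<lambda>x. g x - f x) \<le> \<epsilon>}"

text \<open>
  \<open>T\<close> is only required to be linear on a linear space \<open>V\<close> of functions, so that functionals
  such as point evaluations or derivatives at a point, which are defined neither on all
  functions nor continuously in \<open>L\<^sub>2\<close>, are included.
\<close>

definition linear_functional_on ::
  "('a \<Rightarrow> real) set \<Rightarrow> (('a \<Rightarrow> real) \<Rightarrow> real) \<Rightarrow> bool"
where
  "linear_functional_on V T \<longleftrightarrow>
     (\<lambda>x. 0) \<in> V \<and>
     (\<forall>f\<in>V. \<forall>g\<in>V. (\<lambda>x. f x + g x) \<in> V \<and> T (\<lambda>x. f x + g x) = T f + T g) \<and>
     (\<forall>c. \<forall>f\<in>V. (\<lambda>x. c * f x) \<in> V \<and> T (\<lambda>x. c * f x) = c * T f)"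

text \<open>
  Below, \<open>S\<close> is the measurable space of the data and \<open>P f\<close> is the law of the data on \<open>S\<close> when
  \<open>f\<close> is the truth. The intervals may be open, closed, half-open, degenerate or unbounded.
  Measurability of the events \<open>x \<in> CI\<close> implies measurability of the length, which is
  the supremum of \<open>q - p\<close> over the rationals \<open>p < q\<close> with \<open>p, q \<in> CI\<close> (and \<open>0\<close> if there
  are none).
\<close>

definition data_dependent_interval :: "'y measure \<Rightarrow> ('y \<Rightarrow> real set) \<Rightarrow> bool" where
  "data_dependent_interval S CI \<longleftrightarrow>
     (\<forall>y\<in>space S. is_interval (CI y)) \<and> (\<forall>x. {y \<in> space S. x \<in> CI y} \<in> sets S)"

definition confidence_intervals ::
  "'y measure \<Rightarrow> ('f \<Rightarrow> 'y measure) \<Rightarrow> ('f \<Rightarrow> real) \<Rightarrow> real \<Rightarrow> 'f set \<Rightarrow> ('y \<Rightarrow> real set) set"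
where
  "confidence_intervals S P T \<alpha> F =
     {CI. data_dependent_interval S CI \<and>
          (INF f\<in>F. measure (P f) {y \<in> space S. T f \<in> CI y}) \<ge> 1 - \<alpha>}"

definition max_expected_length ::
  "('f \<Rightarrow> 'y measure) \<Rightarrow> ('y \<Rightarrow> real set) \<Rightarrow> 'f set \<Rightarrow> ennreal"
where
  "max_expected_length P CI G = (SUP f\<in>G. \<integral>\<^sup>+ y. emeasure lborel (CI y) \<partial>P f)"

definition minimax_length ::
  "'y measure \<Rightarrow> ('f \<Rightarrow> 'y measure) \<Rightarrow> ('f \<Rightarrow> real) \<Rightarrow> real \<Rightarrow> 'f set \<Rightarrow> 'f set \<Rightarrow> ennreal"
where
  "minimax_length S P T \<alpha> F1 F =
     (INF CI \<in> confidence_intervals S P T \<alpha> F. max_expected_length P CI F1)"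


subsection \<open>White noise model\<close>

definition wn_interval :: "real set" where
  "wn_interval = {-1/2..1/2}"

text \<open>Functions on \<open>[-1/2, 1/2]\<close> are represented by their extension by \<open>0\<close>. Integrability is
  what the drift \<open>f(t) dt\<close> requires; in particular all functions in \<open>L\<^sub>2\<close> are signals.\<close>

definition wn_signals :: "(real \<Rightarrow> real) set" where
  "wn_signals = {f. integrable (lebesgue_on wn_interval) f \<and> (\<forall>t. t \<notin> wn_interval \<longrightarrow> f t = 0)}"

text \<open>Standard Brownian motion on \<open>[a, b]\<close>, started in \<open>0\<close> at time \<open>a\<close>.\<close>

definition brownian_motion_on :: "real \<Rightarrow> real \<Rightarrow> 'w measure \<Rightarrow> (real \<Rightarrow> 'w \<Rightarrow> real) \<Rightarrow> bool" where
  "brownian_motion_on a b \<Omega> W \<longleftrightarrow>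
     prob_space \<Omega> \<and>
     (\<forall>t\<in>{a..b}. W t \<in> borel_measurable \<Omega>) \<and>
     (\<forall>\<omega>\<in>space \<Omega>. W a \<omega> = 0 \<and> continuous_on {a..b} (\<lambda>t. W t \<omega>)) \<and>
     (\<forall>s t. a \<le> s \<and> s < t \<and> t \<le> b \<longrightarrow>
        distributed \<Omega> lborel (\<lambda>\<omega>. W t \<omega> - W s \<omega>) (normal_density 0 (sqrt (t - s)))) \<and>
     (\<forall>k (\<tau>::nat \<Rightarrow> real). (\<forall>i\<le>k. \<tau> i \<in> {a..b}) \<and> (\<forall>i<k. \<tau> i < \<tau> (Suc i)) \<longrightarrow>
        prob_space.indep_vars \<Omega> (\<lambda>_. borel) (\<lambda>i \<omega>. W (\<tau> (Suc i)) \<omega> - W (\<tau> i) \<omega>) {..<k})"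

text \<open>
  The data are the continuous path \<open>Y\<close> with \<open>Y(-1/2) = 0\<close>, with the \<open>\<sigma>\<close>-algebra on
  the continuous functions generated by the point evaluations.
\<close>

definition wn_data :: "(real \<Rightarrow> real) measure" where
  "wn_data = restrict_space (\<Pi>\<^sub>M t\<in>wn_interval. borel) {y. continuous_on wn_interval y}"

definition wn_observation ::
  "(real \<Rightarrow> 'w \<Rightarrow> real) \<Rightarrow> real \<Rightarrow> (real \<Rightarrow> real) \<Rightarrow> 'w \<Rightarrow> real \<Rightarrow> real"
where
  "wn_observation W n f \<omega> =
     (\<lambda>t\<in>wn_interval. (\<integral>s. f s \<partial>lebesgue_on {-1/2..t}) + W t \<omega> / sqrt n)"

definition wn_law ::
  "'w measure \<Rightarrow> (real \<Rightarrow> 'w \<Rightarrow> real) \<Rightarrow> real \<Rightarrow> (real \<Rightarrow> real) \<Rightarrow> (real \<Rightarrow> real) measure"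
where
  "wn_law \<Omega> W n f = distr \<Omega> wn_data (wn_observation W n f)"


subsection \<open>Gaussian sequence model\<close>

text \<open>Families indexed by \<open>M\<close> are represented by their extension by \<open>0\<close>.\<close>

definition seq_signals :: "'i set \<Rightarrow> ('i \<Rightarrow> real) set" where
  "seq_signals M = {f. \<forall>i. i \<notin> M \<longrightarrow> f i = 0}"

definition iid_std_normal :: "'i set \<Rightarrow> 'w measure \<Rightarrow> ('i \<Rightarrow> 'w \<Rightarrow> real) \<Rightarrow> bool" where
  "iid_std_normal M \<Omega> z \<longleftrightarrow>
     prob_space \<Omega> \<and>
     prob_space.indep_vars \<Omega> (\<lambda>_. borel) z M \<and>
     (\<forall>i\<in>M. distributed \<Omega> lborel (z i) std_normal_density)"

definition seq_data :: "'i set \<Rightarrow> ('i \<Rightarrow> real) measure" where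
  "seq_data M = (\<Pi>\<^sub>M i\<in>M. borel)"

definition seq_observation ::
  "'i set \<Rightarrow> ('i \<Rightarrow> 'w \<Rightarrow> real) \<Rightarrow> real \<Rightarrow> ('i \<Rightarrow> real) \<Rightarrow> 'w \<Rightarrow> 'i \<Rightarrow> real"
where
  "seq_observation M z n f \<omega> = (\<lambda>i\<in>M. f i + z i \<omega> / sqrt n)"

definition seq_law ::
  "'i set \<Rightarrow> 'w measure \<Rightarrow> ('i \<Rightarrow> 'w \<Rightarrow> real) \<Rightarrow> real \<Rightarrow> ('i \<Rightarrow> real) \<Rightarrow> ('i \<Rightarrow> real) measure"
where
  "seq_law M \<Omega> z n f = distr \<Omega> (seq_data M) (seq_observation M z n f)"

end

theory Submission
  imports Defs
begin

text \<open>
  Let \<open>f \<in> F1\<close> and \<open>g \<in> F\<close> with \<open>\<parallel>g - f\<parallel>\<^sub>2 \<le> z\<^sub>\<alpha> / sqrt n\<close>. If the interval contains both \<open>T f\<close> and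
  \<open>T g\<close>, its length is at least \<open>\<bar>T g - T f\<bar>\<close>. Under \<open>f\<close> it contains \<open>T f\<close> with probability at
  least \<open>1 - \<alpha>\<close>; by the Neyman--Pearson lemma, an event of probability at least \<open>1 - \<alpha> = \<Phi>(z\<^sub>\<alpha>)\<close>
  under \<open>g\<close> has probability at least \<open>1/2\<close> under \<open>f\<close>, so it contains \<open>T g\<close> with probability at
  least \<open>1/2\<close>. Hence it contains both with probability at least \<open>1/2 - \<alpha>\<close>.

  The Neyman--Pearson bound needs no infinite-dimensional likelihood ratio: an event of the data
  is approximated, under both laws at once, by one that depends on finitely many coordinates of
  \<open>Y\<close>. In the white noise model these are increments of the path, and by the Cauchy--Schwarz
  inequality on each time interval the standardized mean shift of finitely many increments
  has norm at most \<open>sqrt n * \<parallel>g - f\<parallel>\<^sub>2\<close>.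
\<close>

subsection \<open>Gaussian shifts in finite dimension\<close>

abbreviation "std_normal_cdf \<equiv> cdf std_normal_distribution"

text \<open>The likelihood ratio of a unit normal law with mean \<open>t\<close> against the
  standard one. Completing the square, \<open>(x - t)^2 = x^2 - 2 * t * x + t^2\<close>, gives it as
  the quotient of the two Lebesgue densities.\<close>

lemma distr_std_normal_shift:
  "distr std_normal_distribution borel (\<lambda>x. x + t) =
    density std_normal_distribution (\<lambda>x. ennreal (exp (t * x - t\<^sup>2 / 2)))"
proof -
  interpret N: prob_space std_normal_distribution
    by (rule prob_space_normal_density) simp
  have id: "distributed std_normal_distribution lborel (\<lambda>x. x) std_normal_density"
    by (auto simp: distributed_def distr_id2)
  have "distributed std_normal_distribution lborel (\<lambda>x. t + 1 * x)
      (normal_density (t + 1 * 0) (\<bar>1\<bar> * 1))"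
    by (intro N.normal_density_affine id) auto
  then have "distr std_normal_distribution lborel (\<lambda>x. x + t) = density lborel (normal_density t 1)"
    by (simp add: distributed_distr_eq_density add.commute)
  also have "\<dots> = density std_normal_distribution (\<lambda>x. ennreal (exp (t * x - t\<^sup>2 / 2)))"
    by (subst density_density_eq)
       (auto intro!: density_cong simp: normal_density_def ennreal_mult[symmetric]
         exp_add[symmetric] power2_diff field_simps power2_eq_square simp flip: exp_add)
  finally show ?thesis
    by (simp cong: distr_cong)
qed

text \<open>It suffices to compare both measures on boxes. There the indicator factors over the
  coordinates, so the integral of the product of the \<open>f i\<close> is a product of
  one-dimensional integrals. This turns likelihood ratios of single coordinates into that of a
  random vector.\<close>

lemma PiM_density:
  assumes "finite I" and M: "\<And>i. prob_space (M i)" and D: "\<And>i. i \<in> I \<Longrightarrow> prob_space (density (M i) (f i))"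
    and f[measurable]: "\<And>i. i \<in> I \<Longrightarrow> f i \<in> borel_measurable (M i)"
  shows "(\<Pi>\<^sub>M i\<in>I. density (M i) (f i)) = density (PiM I M) (\<lambda>x. \<Prod>i\<in>I. f i (x i))"
proof -
  \<comment> \<open>The locale of product probability spaces wants a probability measure at every
    index; the density 1 keeps \<open>M i\<close> itself outside \<open>I\<close>.\<close>
  define g where "g i = (if i \<in> I then f i else (\<lambda>_. 1))" for i
  have g[measurable]: "g i \<in> borel_measurable (M i)" for i
    by (auto simp: g_def)
  interpret M: product_prob_space M
    by (simp add: product_prob_space_def product_prob_space_axioms_def product_sigma_finite_def M
        prob_space_imp_sigma_finite)
  interpret G: product_prob_space "\<lambda>i. density (M i) (g i)"
    using D M by (simp add: product_prob_space_def product_prob_space_axioms_def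
        product_sigma_finite_def prob_space_imp_sigma_finite g_def density_1)
  have "density (PiM I M) (\<lambda>x. \<Prod>i\<in>I. g i (x i)) = (\<Pi>\<^sub>M i\<in>I. density (M i) (g i))"
  proof (rule G.PiM_eqI)
    fix A assume A: "\<And>i. i \<in> I \<Longrightarrow> A i \<in> sets (density (M i) (g i))"
    then have [measurable]: "\<And>i. i \<in> I \<Longrightarrow> A i \<in> sets (M i)"
      by simp
    have "emeasure (density (PiM I M) (\<lambda>x. \<Prod>i\<in>I. g i (x i))) (Pi\<^sub>E I A) =
        (\<integral>\<^sup>+x. (\<Prod>i\<in>I. g i (x i) * indicator (A i) (x i)) \<partial>PiM I M)"
      using \<open>finite I\<close> A
      by (subst emeasure_density)
         (auto simp: prod.distrib[symmetric] space_PiM indicator_def PiE_iff prod_zero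
           intro!: nn_integral_cong sets_PiM_I_finite)
    also have "\<dots> = (\<Prod>i\<in>I. \<integral>\<^sup>+x. g i x * indicator (A i) x \<partial>M i)"
      using \<open>finite I\<close> by (intro M.product_nn_integral_prod) auto
    also have "\<dots> = (\<Prod>i\<in>I. emeasure (density (M i) (g i)) (A i))"
      by (intro prod.cong) (auto simp: emeasure_density)
    finally show "emeasure (density (PiM I M) (\<lambda>x. \<Prod>i\<in>I. g i (x i))) (Pi\<^sub>E I A) =
      (\<Prod>i\<in>I. emeasure (density (M i) (g i)) (A i))" .
  qed (use \<open>finite I\<close> in \<open>auto cong: sets_PiM_cong\<close>)
  then show ?thesis
    by (simp add: g_def cong: PiM_cong)
qed

section \<open>The Neyman-Pearson lemma and its Gaussian case\<close>

text \<open>Both sides integrate \<open>L - k\<close> with respect to \<open>P\<close>, over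
  \<open>A\<close> and over \<open>C\<close>. As \<open>C\<close> collects exactly the points where
  \<open>L - k\<close> is nonnegative, no event has a larger integral: \<open>A - C\<close>
  contributes at most 0, \<open>C - A\<close> at least 0, and \<open>A \<inter> C\<close>
  cancels.\<close>

lemma Neyman_Pearson:
  fixes L :: "'a \<Rightarrow> real"
  assumes P: "prob_space P" and Q: "prob_space (density P L)"
    and L[measurable]: "L \<in> borel_measurable P" and k: "0 \<le> k"
    and A[measurable]: "A \<in> sets P"
  defines "C \<equiv> {x \<in> space P. k \<le> L x}"
  shows "measure (density P L) A - k * measure P A \<le> measure (density P L) C - k * measure P C"
proof -
  interpret P: prob_space P by fact
  interpret Q: prob_space "density P L" by fact
  have [measurable]: "C \<in> sets P"
    by (simp add: C_def)
  have "emeasure (density P L) (A - C) \<le> (\<integral>\<^sup>+x. ennreal k * indicator (A - C) x \<partial>P)"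
    by (subst emeasure_density) (auto intro!: nn_integral_mono simp: C_def indicator_def ennreal_leI)
  also have "\<dots> = ennreal (k * measure P (A - C))"
    using k by (simp add: nn_integral_cmult_indicator P.emeasure_eq_measure ennreal_mult)
  finally have 1: "measure (density P L) (A - C) \<le> k * measure P (A - C)"
    using k by (simp add: Q.emeasure_eq_measure)
  have "ennreal (k * measure P (C - A)) = (\<integral>\<^sup>+x. ennreal k * indicator (C - A) x \<partial>P)"
    using k by (simp add: nn_integral_cmult_indicator P.emeasure_eq_measure ennreal_mult)
  also have "\<dots> \<le> emeasure (density P L) (C - A)"
    by (subst emeasure_density) (auto intro!: nn_integral_mono simp: C_def indicator_def ennreal_leI)
  finally have 2: "k * measure P (C - A) \<le> measure (density P L) (C - A)"
    by (simp add: Q.emeasure_eq_measure)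
  have split: "measure R A = measure R (A \<inter> C) + measure R (A - C)"
    "measure R C = measure R (A \<inter> C) + measure R (C - A)"
    if "finite_measure R" "sets R = sets P" for R
  proof -
    have "A \<in> sets R" "C \<in> sets R"
      using that by auto
    then show "measure R A = measure R (A \<inter> C) + measure R (A - C)"
      "measure R C = measure R (A \<inter> C) + measure R (C - A)"
      using finite_measure.finite_measure_Diff'[OF that(1)] by (simp_all add: Int_commute)
  qed
  note split[of P, OF P.finite_measure_axioms] split[of "density P L", OF Q.finite_measure_axioms]
  then show ?thesis
    using 1 2 by (simp add: algebra_simps)
qed

text \<open>By symmetry, \<open>- X\<close> is standard normal as well.\<close>

lemma (in prob_space) std_normal_tail:
  assumes X: "distributed M lborel X std_normal_density"
  shows "prob {\<omega> \<in> space M. - x \<le> X \<omega>} = std_normal_cdf x"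
proof -
  have [measurable]: "X \<in> borel_measurable M"
    using distributed_measurable[OF X] by simp
  have "distributed M lborel (\<lambda>\<omega>. 0 + (-1) * X \<omega>) (normal_density (0 + (-1) * 0) (\<bar>-1\<bar> * 1))"
    by (intro normal_density_affine X) auto
  then have "std_normal_distribution = distr M lborel (\<lambda>\<omega>. - X \<omega>)"
    by (simp add: distributed_distr_eq_density)
  then have "std_normal_cdf x = measure (distr M lborel (\<lambda>\<omega>. - X \<omega>)) {..x}"
    by (simp add: cdf_def)
  also have "\<dots> = prob {\<omega> \<in> space M. - x \<le> X \<omega>}"
    by (subst measure_distr) (auto intro!: arg_cong[where f=prob])
  finally show ?thesis ..
qed

text \<open>By symmetry the two closed half-lines at 0 have equal mass, and since the point 0 has
  none, these masses add up to 1.\<close>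

lemma std_normal_cdf_0: "std_normal_cdf 0 = 1 / 2"
proof -
  interpret N: prob_space std_normal_distribution
    by (rule prob_space_normal_density) simp
  have id: "distributed std_normal_distribution lborel (\<lambda>x. x) std_normal_density"
    by (auto simp: distributed_def distr_id2)
  have "measure std_normal_distribution {0} = 0"
    by (simp add: measure_def emeasure_density nn_integral_indicator_singleton)
  then have "measure std_normal_distribution ({..<0} \<union> {0}) = measure std_normal_distribution {..<0}"
    by (subst N.finite_measure_Union) auto
  moreover have "{..<0} \<union> {0} = {..0::real}"
    by auto
  moreover have "measure std_normal_distribution (UNIV - {0..}) = 1 - measure std_normal_distribution {0..}"
    using N.prob_compl[of "{0..}"] by simp
  moreover have "UNIV - {0..} = {..<0::real}"
    by auto
  ultimately show ?thesis
    using N.std_normal_tail[OF id, of 0] by (simp add: cdf_def atLeast_def)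
qed

text \<open>The likelihood ratio of the shift is \<open>exp\<close> of a linear form minus
  \<open>d^2 / 2\<close>, so the optimal tests are half-spaces orthogonal to
  \<open>\<theta>\<close>. The one bounded by the hyperplane through 0, where the ratio equals
  \<open>exp (- d^2 / 2)\<close>, has probability 1/2 without the shift and
  \<open>std_normal_cdf d\<close> with it. The claim is the Neyman-Pearson inequality against this
  half-space.\<close>

lemma (in prob_space) Gaussian_shift_bound_pos:
  fixes Z :: "'i \<Rightarrow> 'a \<Rightarrow> real" and \<theta> :: "'i \<Rightarrow> real"
  assumes I: "finite I" and indep: "indep_vars (\<lambda>_. borel) Z I"
    and normal: "\<And>i. i \<in> I \<Longrightarrow> distributed M lborel (Z i) std_normal_density"
    and A[measurable]: "A \<in> sets (\<Pi>\<^sub>M i\<in>I. borel)"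
  defines "d \<equiv> sqrt (\<Sum>i\<in>I. (\<theta> i)\<^sup>2)"
  assumes d: "d > 0"
  shows "prob {\<omega> \<in> space M. (\<lambda>i\<in>I. Z i \<omega> + \<theta> i) \<in> A}
      - exp (- d\<^sup>2 / 2) * prob {\<omega> \<in> space M. (\<lambda>i\<in>I. Z i \<omega>) \<in> A}
    \<le> std_normal_cdf d - exp (- d\<^sup>2 / 2) / 2"
proof -
  let ?N = std_normal_distribution
  let ?B = "\<Pi>\<^sub>M i\<in>I. borel :: real measure"
  interpret N: prob_space ?N
    by (rule prob_space_normal_density) simp
  have [simp]: "I \<noteq> {}"
    using d by (auto simp: d_def)
  have [measurable]: "Z i \<in> borel_measurable M" if "i \<in> I" for i
    using distributed_measurable[OF normal[OF that]] by simp
  have distr_Z: "distr M borel (Z i) = ?N" if "i \<in> I" for i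
    using distributed_distr_eq_density[OF normal[OF that]] by (simp cong: distr_cong)
  have d2: "d\<^sup>2 = (\<Sum>i\<in>I. (\<theta> i)\<^sup>2)"
    by (simp add: d_def sum_nonneg)
  define P where "P = (\<Pi>\<^sub>M i\<in>I. ?N)"
  define L where "L x = exp ((\<Sum>i\<in>I. \<theta> i * x i) - d\<^sup>2 / 2)" for x :: "'i \<Rightarrow> real"
  have sets_P[measurable_cong]: "sets P = sets ?B"
    by (auto simp: P_def cong: sets_PiM_cong)
  have P: "distr M ?B (\<lambda>\<omega>. \<lambda>i\<in>I. Z i \<omega>) = P"
    using indep_vars_iff_distr_eq_PiM'[where I=I and M'="\<lambda>_. borel" and X=Z] indep
    by (auto simp: P_def distr_Z cong: PiM_cong)
  have "indep_vars (\<lambda>_. borel) (\<lambda>i \<omega>. Z i \<omega> + \<theta> i) I"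
    using indep by (rule indep_vars_compose2) auto
  then have "distr M ?B (\<lambda>\<omega>. \<lambda>i\<in>I. Z i \<omega> + \<theta> i) = (\<Pi>\<^sub>M i\<in>I. distr M borel (\<lambda>\<omega>. Z i \<omega> + \<theta> i))"
    by (subst indep_vars_iff_distr_eq_PiM'[symmetric]) auto
  also have "\<dots> = (\<Pi>\<^sub>M i\<in>I. density ?N (\<lambda>x. ennreal (exp (\<theta> i * x - (\<theta> i)\<^sup>2 / 2))))"
  proof (rule PiM_cong)
    fix i assume i: "i \<in> I"
    have "distr M borel (\<lambda>\<omega>. Z i \<omega> + \<theta> i) = distr (distr M borel (Z i)) borel (\<lambda>x. x + \<theta> i)"
      using i by (subst distr_distr) (auto simp: comp_def)
    then show "distr M borel (\<lambda>\<omega>. Z i \<omega> + \<theta> i) = density ?N (\<lambda>x. ennreal (exp (\<theta> i * x - (\<theta> i)\<^sup>2 / 2)))"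
      using i by (simp add: distr_Z distr_std_normal_shift)
  qed simp
  also have "\<dots> = density P (\<lambda>x. \<Prod>i\<in>I. ennreal (exp (\<theta> i * x i - (\<theta> i)\<^sup>2 / 2)))"
    unfolding P_def
  proof (rule PiM_density)
    show "prob_space (density ?N (\<lambda>x. ennreal (exp (\<theta> i * x - (\<theta> i)\<^sup>2 / 2))))" for i
      unfolding distr_std_normal_shift[symmetric] by (rule N.prob_space_distr) simp
  qed (auto intro: I N.prob_space_axioms)
  also have "\<dots> = density P L"
    by (rule density_cong)
       (auto simp: L_def prod_ennreal exp_sum[OF I, symmetric] d2 sum_subtractf sum_divide_distrib)
  finally have Q: "distr M ?B (\<lambda>\<omega>. \<lambda>i\<in>I. Z i \<omega> + \<theta> i) = density P L" .
  have prob_P: "prob_space P"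
    unfolding P[symmetric] by (rule prob_space_distr) simp
  have prob_Q: "prob_space (density P L)"
    unfolding Q[symmetric] by (rule prob_space_distr) simp
  have L[measurable]: "L \<in> borel_measurable P"
    unfolding L_def by measurable
  have measure_P: "measure P A = prob {\<omega> \<in> space M. (\<lambda>i\<in>I. Z i \<omega>) \<in> A}"
    if "A \<in> sets ?B" for A
    unfolding P[symmetric] using that
    by (subst measure_distr) (auto intro!: arg_cong[where f=prob])
  have measure_Q: "measure (density P L) A = prob {\<omega> \<in> space M. (\<lambda>i\<in>I. Z i \<omega> + \<theta> i) \<in> A}"
    if "A \<in> sets ?B" for A
    unfolding Q[symmetric] using that
    by (subst measure_distr) (auto intro!: arg_cong[where f=prob])

  \<comment> \<open>the threshold for which the most powerful test has level \<open>1/2\<close> under \<open>P\<close>\<close>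
  define C where "C = {x \<in> space P. exp (- d\<^sup>2 / 2) \<le> L x}"
  have C: "C \<in> sets ?B"
    unfolding C_def sets_P[symmetric] by measurable
  have C_iff: "x \<in> C \<longleftrightarrow> x \<in> space ?B \<and> 0 \<le> (\<Sum>i\<in>I. \<theta> i * x i)" for x
    by (simp add: C_def L_def sets_eq_imp_space_eq[OF sets_P])

  \<comment> \<open>the library's sums of normal variables require positive variances\<close>
  define J where "J = {i \<in> I. \<theta> i \<noteq> 0}"
  \<comment> \<open>The projection of \<open>Z\<close> on the unit vector in direction
    \<open>\<theta>\<close>, hence standard normal. The summand \<open>0 +\<close> matches the form
    of \<open>normal_density_affine\<close>.\<close>
  define U where "U \<omega> = (\<Sum>i\<in>J. 0 + (\<theta> i / d) * Z i \<omega>)" for \<omega>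
  have J: "finite J" "J \<subseteq> I"
    using I by (auto simp: J_def)
  have d2_J: "d\<^sup>2 = (\<Sum>i\<in>J. (\<theta> i)\<^sup>2)"
    unfolding d2 J_def using I by (intro sum.mono_neutral_right) auto
  have "distributed M lborel U
    (normal_density (\<Sum>i\<in>J. 0 + (\<theta> i / d) * 0) (sqrt (\<Sum>i\<in>J. (\<bar>\<theta> i / d\<bar> * 1)\<^sup>2)))"
    unfolding U_def
  proof (rule sum_indep_normal)
    show "J \<noteq> {}"
      using d2_J d by auto
    have "indep_vars (\<lambda>_. borel) Z J"
      using indep J by (blast intro: indep_vars_subset)
    then show "indep_vars (\<lambda>_. borel) (\<lambda>i \<omega>. 0 + (\<theta> i / d) * Z i \<omega>) J"
      by (rule indep_vars_compose2) auto
    show "distributed M lborel (\<lambda>\<omega>. 0 + (\<theta> i / d) * Z i \<omega>) (normal_density (0 + \<theta> i / d * 0) (\<bar>\<theta> i / d\<bar> * 1))"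
      if "i \<in> J" for i
      using that d J by (intro normal_density_affine normal) (auto simp: J_def)
  qed (use J d in \<open>auto simp: J_def\<close>)
  moreover have "(\<Sum>i\<in>J. (\<bar>\<theta> i / d\<bar> * 1)\<^sup>2) = 1"
    using d by (simp add: power_divide flip: sum_divide_distrib d2_J)
  ultimately have U: "distributed M lborel U std_normal_density"
    by simp
  have U_eq: "(\<Sum>i\<in>I. \<theta> i * Z i \<omega>) = d * U \<omega>" for \<omega>
  proof -
    have "(\<Sum>i\<in>I. \<theta> i * Z i \<omega>) = (\<Sum>i\<in>J. \<theta> i * Z i \<omega>)"
      unfolding J_def using I by (intro sum.mono_neutral_right) auto
    then show ?thesis
      using d by (simp add: U_def sum_distrib_left)
  qed
  have "measure P C = prob {\<omega> \<in> space M. - 0 \<le> U \<omega>}"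
    using d by (auto simp: measure_P[OF C] C_iff U_eq space_PiM zero_le_mult_iff
        intro!: arg_cong[where f=prob])
  then have 1: "measure P C = 1 / 2"
    by (simp only: std_normal_tail[OF U] std_normal_cdf_0)
  \<comment> \<open>Shifting \<open>Z\<close> by \<open>\<theta>\<close> adds \<open>d^2\<close> to
    the linear form \<open>d * U\<close>, so under the shift \<open>C\<close> becomes a tail event
    of \<open>U\<close>.\<close>
  have "0 \<le> d * U \<omega> + d\<^sup>2 \<longleftrightarrow> - d \<le> U \<omega>" for \<omega>
  proof -
    have "d * U \<omega> + d\<^sup>2 = d * (U \<omega> + d)"
      by (simp add: power2_eq_square algebra_simps)
    then show ?thesis
      using d by (auto simp: zero_le_mult_iff)
  qed
  then have "measure (density P L) C = prob {\<omega> \<in> space M. - d \<le> U \<omega>}"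
    by (auto simp: measure_Q[OF C] C_iff space_PiM distrib_left sum.distrib U_eq
        power2_eq_square[symmetric] d2[symmetric] intro!: arg_cong[where f=prob])
  then have 2: "measure (density P L) C = std_normal_cdf d"
    by (simp add: std_normal_tail[OF U])
  show ?thesis
    using Neyman_Pearson[OF prob_P prob_Q L, of "exp (- d\<^sup>2 / 2)" A] 1 2
    by (simp add: sets_P measure_P[OF A] measure_Q[OF A] flip: C_def[simplified])
qed

text \<open>Makes the bound uniform over all shifts of norm at most \<open>z\<close>. The factor
  \<open>exp (- d^2 / 2)\<close> lies between \<open>exp (- z^2 / 2)\<close> and 1; which end gives
  the larger product depends on the sign of \<open>p - 1 / 2\<close>, whence the maximum. The
  constants no longer involve \<open>\<theta>\<close> or \<open>I\<close>, as a passage to the limit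
  over finite sets of coordinates requires.\<close>

lemma (in prob_space) Gaussian_shift_bound:
  fixes Z :: "'i \<Rightarrow> 'a \<Rightarrow> real" and \<theta> :: "'i \<Rightarrow> real"
  assumes I: "finite I" and indep: "indep_vars (\<lambda>_. borel) Z I"
    and normal: "\<And>i. i \<in> I \<Longrightarrow> distributed M lborel (Z i) std_normal_density"
    and A[measurable]: "A \<in> sets (\<Pi>\<^sub>M i\<in>I. borel)"
    and d: "(\<Sum>i\<in>I. (\<theta> i)\<^sup>2) \<le> z\<^sup>2" "0 \<le> z"
  defines "p \<equiv> prob {\<omega> \<in> space M. (\<lambda>i\<in>I. Z i \<omega>) \<in> A}"
  shows "prob {\<omega> \<in> space M. (\<lambda>i\<in>I. Z i \<omega> + \<theta> i) \<in> A} - std_normal_cdf z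
    \<le> max (p - 1 / 2) (exp (- z\<^sup>2 / 2) * (p - 1 / 2))"
proof -
  interpret N: real_distribution std_normal_distribution
    by (rule real_dist_normal_dist)
  define d where "d = sqrt (\<Sum>i\<in>I. (\<theta> i)\<^sup>2)"
  have "0 \<le> d" "d \<le> z"
    using d real_le_rsqrt[of d z] by (auto simp: d_def sum_nonneg real_sqrt_le_iff' intro!: real_le_lsqrt)
  have "prob {\<omega> \<in> space M. (\<lambda>i\<in>I. Z i \<omega> + \<theta> i) \<in> A} - std_normal_cdf d \<le> exp (- d\<^sup>2 / 2) * (p - 1 / 2)"
  proof (cases "d > 0")
    case True
    then show ?thesis
      using Gaussian_shift_bound_pos[OF I indep normal A, of \<theta>]
      by (simp add: p_def d_def algebra_simps)
  next
    \<comment> \<open>Without a shift both events coincide, and the claim reads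
      \<open>p - 1 / 2 \<le> p - 1 / 2\<close>.\<close>
    case False
    then have "d = 0" "(\<Sum>i\<in>I. (\<theta> i)\<^sup>2) = 0"
      using \<open>0 \<le> d\<close> by (auto simp: d_def)
    then have "\<And>i. i \<in> I \<Longrightarrow> \<theta> i = 0"
      using I by (simp add: sum_nonneg_eq_0_iff)
    then have "(\<lambda>i\<in>I. Z i \<omega> + \<theta> i) = (\<lambda>i\<in>I. Z i \<omega>)" for \<omega>
      by auto
    then show ?thesis
      using \<open>d = 0\<close> by (simp add: p_def std_normal_cdf_0)
  qed
  also have "exp (- d\<^sup>2 / 2) * (p - 1 / 2) \<le> max (p - 1 / 2) (exp (- z\<^sup>2 / 2) * (p - 1 / 2))"
  proof (cases "p \<ge> 1 / 2")
    case True
    have "exp (- d\<^sup>2 / 2) * (p - 1 / 2) \<le> 1 * (p - 1 / 2)"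
      using True by (intro mult_right_mono) auto
    then show ?thesis
      by simp
  next
    case False
    have "exp (- z\<^sup>2 / 2) \<le> exp (- d\<^sup>2 / 2)"
      using \<open>0 \<le> d\<close> \<open>d \<le> z\<close> by (simp add: power_mono)
    then have "exp (- d\<^sup>2 / 2) * (p - 1 / 2) \<le> exp (- z\<^sup>2 / 2) * (p - 1 / 2)"
      using False by (intro mult_right_mono_neg) auto
    then show ?thesis
      by simp
  qed
  finally show ?thesis
    using N.cdf_nondecreasing[OF \<open>d \<le> z\<close>] by simp
qed

subsection \<open>Approximation by cylinder sets\<close>

text \<open>Induction over the generation of \<open>A\<close>, with one approximating set serving
  both measures throughout. A countable union is first cut to finitely many sets, at a cost below
  \<open>e / 2\<close>; each of the \<open>n\<close> remaining sets is then approximated within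
  \<open>e / (2 * n)\<close>, so the induction has to be general in \<open>e\<close>.\<close>

lemma algebra_approximates_sigma_sets:
  fixes P Q :: "'a measure"
  assumes "finite_measure P" "finite_measure Q" and G: "algebra \<Omega> G"
    and sets: "sets P = sigma_sets \<Omega> G" "sets Q = sigma_sets \<Omega> G"
    and A: "A \<in> sigma_sets \<Omega> G" and e: "e > 0"
  shows "\<exists>B\<in>G. measure P (sym_diff A B) < e \<and> measure Q (sym_diff A B) < e"
proof -
  interpret P: finite_measure P by fact
  interpret Q: finite_measure Q by fact
  interpret G: algebra \<Omega> G by fact
  have sets_PQ: "sets Q = sets P"
    using sets by simp
  have G_sets[measurable]: "B \<in> sets P" if "B \<in> G" for B
    using that by (simp add: sets sigma_sets.Basic)
  have space: "space P = \<Omega>"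
    using sets(1) G.space_closed by (metis sets.sigma_sets_eq sets_measure_of space_measure_of
        measure_of_of_measure sets_eq_imp_space_eq)
  show ?thesis
    using A e
  proof (induction arbitrary: e)
    case (Basic A)
    then show ?case
      by (intro bexI[of _ A]) auto
  next
    case Empty
    then show ?case
      by (intro bexI[of _ "{}"]) auto
  next
    case (Compl A)
    then obtain B where B: "B \<in> G" "measure P (sym_diff A B) < e" "measure Q (sym_diff A B) < e"
      by blast
    have "A \<subseteq> \<Omega>" "B \<subseteq> \<Omega>"
      using Compl(1) B(1) sigma_sets_into_sp[OF G.space_closed] G.space_closed by auto
    then have "sym_diff (\<Omega> - A) (\<Omega> - B) = sym_diff A B"
      by auto
    then show ?case
      using B by (intro bexI[of _ "\<Omega> - B"]) auto
  next
    case (Union A)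
    have A[measurable]: "A i \<in> sets P" for i
      using Union(1) sets by simp
    have "\<exists>N. \<forall>n\<ge>N. measure R ((\<Union>i. A i) - (\<Union>i<n. A i)) < e / 2"
      if "finite_measure R" "sets R = sets P" for R
    proof -
      interpret R: finite_measure R by fact
      have [measurable]: "A i \<in> sets R" for i
        using A that by simp
      have "(\<lambda>n. measure R (\<Union>i<n. A i)) \<longlonglongrightarrow> measure R (\<Union>n. \<Union>i<n. A i)"
        by (intro R.finite_Lim_measure_incseq) (auto simp: incseq_def intro: less_le_trans)
      also have "(\<Union>n. \<Union>i<n. A i) = (\<Union>i. A i)"
        by auto
      finally have "\<forall>\<^sub>F n in sequentially. measure R (\<Union>i. A i) - e / 2 < measure R (\<Union>i<n. A i)"
        using \<open>e > 0\<close> by (intro order_tendstoD) auto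
      then have "\<forall>\<^sub>F n in sequentially. measure R ((\<Union>i. A i) - (\<Union>i<n. A i)) < e / 2"
        by eventually_elim (subst R.finite_measure_Diff, auto)
      then show ?thesis
        by (simp add: eventually_sequentially)
    qed
    then obtain N N' where N: "\<And>n. n \<ge> N \<Longrightarrow> measure P ((\<Union>i. A i) - (\<Union>i<n. A i)) < e / 2"
      "\<And>n. n \<ge> N' \<Longrightarrow> measure Q ((\<Union>i. A i) - (\<Union>i<n. A i)) < e / 2"
      using P.finite_measure_axioms Q.finite_measure_axioms sets_PQ by metis
    \<comment> \<open>Large enough for both tails; \<open>Suc\<close> keeps \<open>n\<close>
      positive, so that \<open>e / (2 * n)\<close> is a legitimate accuracy.\<close>
    define n where "n = Suc (max N N')"
    have n: "n > 0" "n \<ge> N" "n \<ge> N'"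
      by (auto simp: n_def)
    have "\<exists>B\<in>G. measure P (sym_diff (A i) B) < e / (2 * n) \<and> measure Q (sym_diff (A i) B) < e / (2 * n)" for i
      using \<open>e > 0\<close> n by (intro Union.IH) auto
    then obtain B where B: "\<And>i. B i \<in> G" "\<And>i. measure P (sym_diff (A i) (B i)) < e / (2 * n)"
      "\<And>i. measure Q (sym_diff (A i) (B i)) < e / (2 * n)"
      by metis
    have [measurable]: "B i \<in> sets P" for i
      using B(1) by (rule G_sets)
    have "measure R (sym_diff (\<Union>i. A i) (\<Union>i<n. B i)) < e"
      if R: "finite_measure R" "sets R = sets P" and tail: "measure R ((\<Union>i. A i) - (\<Union>i<n. A i)) < e / 2"
        and step: "\<And>i. measure R (sym_diff (A i) (B i)) < e / (2 * n)" for R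
    proof -
      interpret R: finite_measure R by fact
      have [measurable]: "A i \<in> sets R" "B i \<in> sets R" for i
        using R by simp_all
      have "sym_diff (\<Union>i. A i) (\<Union>i<n. B i) \<subseteq>
          ((\<Union>i. A i) - (\<Union>i<n. A i)) \<union> (\<Union>i<n. sym_diff (A i) (B i))"
        by blast
      then have "measure R (sym_diff (\<Union>i. A i) (\<Union>i<n. B i)) \<le>
          measure R (((\<Union>i. A i) - (\<Union>i<n. A i)) \<union> (\<Union>i<n. sym_diff (A i) (B i)))"
        by (intro R.finite_measure_mono) auto
      also have "\<dots> \<le> measure R ((\<Union>i. A i) - (\<Union>i<n. A i)) + measure R (\<Union>i<n. sym_diff (A i) (B i))"
        by (intro measure_Un_le) auto
      also have "measure R (\<Union>i<n. sym_diff (A i) (B i)) \<le> (\<Sum>i<n. measure R (sym_diff (A i) (B i)))"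
        by (intro R.finite_measure_subadditive_finite) auto
      also have "\<dots> \<le> (\<Sum>i<n. e / (2 * n))"
        by (intro sum_mono less_imp_le step)
      also have "\<dots> = e / 2"
        using n by simp
      finally show ?thesis
        using tail by simp
    qed
    then have "measure P (sym_diff (\<Union>i. A i) (\<Union>i<n. B i)) < e"
      "measure Q (sym_diff (\<Union>i. A i) (\<Union>i<n. B i)) < e"
      using P.finite_measure_axioms Q.finite_measure_axioms sets_PQ B N n by blast+
    moreover have "(\<Union>i<n. B i) \<in> G"
      using B by auto
    ultimately show ?case
      by blast
  qed
qed

lemma (in finite_measure) abs_measure_diff_le_sym_diff:
  assumes [measurable]: "A \<in> sets M" "B \<in> sets M"
  shows "\<bar>measure M A - measure M B\<bar> \<le> measure M (sym_diff A B)"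
proof -
  have "measure M A = measure M (A \<inter> B) + measure M (A - B)"
    "measure M B = measure M (A \<inter> B) + measure M (B - A)"
    using finite_measure_Diff'[of A B] finite_measure_Diff'[of B A] by (simp_all add: Int_commute)
  moreover have "measure M (A - B) \<le> measure M (sym_diff A B)" "measure M (B - A) \<le> measure M (sym_diff A B)"
    by (auto intro!: finite_measure_mono)
  ultimately show ?thesis
    using measure_nonneg[of M "A - B"] measure_nonneg[of M "B - A"] by linarith
qed

text \<open>The cylinders over finite index sets form an algebra that generates the product
  sigma-algebra, and the probabilities of two events differ by at most that of their symmetric
  difference.\<close>

lemma PiM_approximation_by_cylinders:
  fixes P Q :: "('i \<Rightarrow> 'b) measure"
  assumes P: "finite_measure P" "sets P = sets (PiM T M)"
    and Q: "finite_measure Q" "sets Q = sets (PiM T M)"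
    and prob: "\<And>i. prob_space (M i)"
    and A: "A \<in> sets (PiM T M)" and e: "e > 0"
  obtains J B where "finite J" "J \<subseteq> T" "B \<in> sets (PiM J M)"
    "\<bar>measure P A - measure P (prod_emb T M J B)\<bar> < e"
    "\<bar>measure Q A - measure Q (prod_emb T M J B)\<bar> < e"
proof -
  interpret M: product_prob_space M T
    by (simp add: product_prob_space_def product_prob_space_axioms_def product_sigma_finite_def prob
        prob_space_imp_sigma_finite)
  obtain C where C: "C \<in> M.generator" "measure P (sym_diff A C) < e" "measure Q (sym_diff A C) < e"
    using algebra_approximates_sigma_sets[OF P(1) Q(1) M.algebra_generator _ _ _ e, of A] A
    by (auto simp: P Q M.sets_PiM_generator)
  from C(1) obtain J B where J: "finite J" "J \<subseteq> T" "B \<in> sets (PiM J M)" "C = prod_emb T M J B"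
    by (auto elim: M.generator.cases)
  then have "C \<in> sets (PiM T M)"
    by (auto intro!: measurable_prod_emb)
  then have "\<bar>measure P A - measure P C\<bar> < e" "\<bar>measure Q A - measure Q C\<bar> < e"
    using finite_measure.abs_measure_diff_le_sym_diff[OF P(1), of A C]
      finite_measure.abs_measure_diff_le_sym_diff[OF Q(1), of A C] A C P Q by auto
  then show ?thesis
    using that J by blast
qed

text \<open>
  Unlike the implication from \<open>q \<le> Q A\<close> to \<open>r \<le> P A\<close>, the hypothesis on cylinders is a closed
  condition on the pair of probabilities and therefore passes to the limit.
\<close>

lemma PiM_power_bound:
  fixes P Q :: "('i \<Rightarrow> real) measure"
  assumes P: "prob_space P" "sets P = sets (\<Pi>\<^sub>M i\<in>T. borel)"
    and Q: "prob_space Q" "sets Q = sets (\<Pi>\<^sub>M i\<in>T. borel)"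
    and A: "A \<in> sets (\<Pi>\<^sub>M i\<in>T. borel)" and c: "0 < c"
    and cylinder: "\<And>J B. finite J \<Longrightarrow> J \<subseteq> T \<Longrightarrow> B \<in> sets (\<Pi>\<^sub>M i\<in>J. borel) \<Longrightarrow>
      measure Q (prod_emb T (\<lambda>_. borel) J B) - q \<le>
        max (measure P (prod_emb T (\<lambda>_. borel) J B) - r) (c * (measure P (prod_emb T (\<lambda>_. borel) J B) - r))"
    and q: "q \<le> measure Q A"
  shows "r \<le> measure P A"
proof (rule ccontr)
  assume less: "\<not> r \<le> measure P A"
  \<comment> \<open>If the claim fails, both terms of the maximum, evaluated at \<open>A\<close>
    itself, are at most \<open>- \<eta>\<close>. Passing to a cylinder costs less than
    \<open>e\<close> on the side of \<open>Q\<close> and less than \<open>e + c * e\<close> in the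
    maximum, which explains \<open>e = \<eta> / (2 + c)\<close>.\<close>
  define \<eta> where "\<eta> = min 1 c * (r - measure P A)"
  have \<eta>: "\<eta> > 0" "\<eta> \<le> r - measure P A" "\<eta> \<le> c * (r - measure P A)"
    using less c by (auto simp: \<eta>_def min_def mult_left_le_one_le)
  define e where "e = \<eta> / (2 + c)"
  have e: "e > 0" "e * (2 + c) = \<eta>"
    using \<eta> c by (auto simp: e_def)
  \<comment> \<open>The approximation lemma asks for probability measures as components; point
    masses supply them and have the measurable sets of \<open>borel\<close>.\<close>
  let ?M = "\<lambda>_::'i. return borel (0::real)"
  have sets_M: "sets (PiM I ?M) = sets (\<Pi>\<^sub>M i\<in>I. borel)" for I
    by (auto cong: sets_PiM_cong)
  have emb: "prod_emb T ?M J B = prod_emb T (\<lambda>_. borel) J B" for J B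
    by (simp add: prod_emb_def)
  obtain J B where JB: "finite J" "J \<subseteq> T" "B \<in> sets (\<Pi>\<^sub>M i\<in>J. borel)"
    "\<bar>measure P A - measure P (prod_emb T (\<lambda>_. borel) J B)\<bar> < e"
    "\<bar>measure Q A - measure Q (prod_emb T (\<lambda>_. borel) J B)\<bar> < e"
    by (rule PiM_approximation_by_cylinders[where M="?M" and P=P and Q=Q and T=T and A=A and e=e])
      (auto simp: sets_M emb P Q A e prob_space_return prob_space.finite_measure)
  let ?p = "measure P (prod_emb T (\<lambda>_. borel) J B)"
  have "?p - r < e - \<eta>"
    using JB(4) \<eta>(2) by linarith
  moreover have "c * (?p - r) < c * (measure P A + e - r)"
    using JB(4) c by (intro mult_strict_left_mono) auto
  then have "c * (?p - r) < c * e - \<eta>"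
    using \<eta>(3) by (simp add: algebra_simps)
  moreover have "c * e > 0"
    using c e by simp
  ultimately have "max (?p - r) (c * (?p - r)) < c * e + e - \<eta>"
    using e(1) by simp
  then show False
    using cylinder[OF JB(1-3)] JB(5) q e by (simp add: algebra_simps)
qed

subsection \<open>Reduction to a bound on the power of tests\<close>

text \<open>\<open>the_inv\<close> is the true inverse at \<open>1 - \<alpha>\<close> once the
  distribution function is injective and attains this value. The positive density makes it strictly
  increasing, the absence of atoms makes it continuous, and the intermediate value theorem applies
  because it is 1/2 at 0 and tends to 1.\<close>

lemma normal_quantile:
  assumes "0 < \<alpha>" "\<alpha> < 1 / 2"
  shows std_normal_cdf_quantile: "std_normal_cdf (normal_quantile \<alpha>) = 1 - \<alpha>"
    and normal_quantile_pos: "0 < normal_quantile \<alpha>"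
proof -
  interpret N: real_distribution std_normal_distribution
    by (rule real_dist_normal_dist)
  have less: "std_normal_cdf x < std_normal_cdf y" if "x < y" for x y
  proof -
    have "emeasure std_normal_distribution {x<..y} \<noteq> 0"
    proof
      assume "emeasure std_normal_distribution {x<..y} = 0"
      then have "AE t in lborel. t \<notin> {x<..y}"
        using normal_density_pos[of 1 0]
        by (simp add: emeasure_density nn_integral_0_iff_AE indicator_def ennreal_eq_0_iff flip: not_less)
      then have "{x<..y} \<in> null_sets lborel"
        by (subst AE_iff_null_sets) auto
      then show False
        using that by (simp add: null_sets_def)
    qed
    then have "measure std_normal_distribution {x<..y} > 0"
      by (simp add: N.emeasure_eq_measure zero_less_measure_iff)
    then show ?thesis
      using N.cdf_diff_eq[OF that] by simp
  qed
  have "measure std_normal_distribution {x} = 0" for x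
    by (simp add: measure_def emeasure_density nn_integral_indicator_singleton)
  then have cont: "isCont std_normal_cdf x" for x
    by (simp add: N.isCont_cdf)
  have "\<forall>\<^sub>F x in at_top. 1 - \<alpha> < std_normal_cdf x"
    using N.cdf_lim_at_top_prob assms by (intro order_tendstoD) auto
  then obtain b where b: "1 - \<alpha> < std_normal_cdf b" "0 \<le> b"
    by (metis eventually_at_top_linorder linorder_le_cases order_refl)
  then obtain x where "std_normal_cdf x = 1 - \<alpha>"
    using IVT[of std_normal_cdf 0 "1 - \<alpha>" b] cont assms by (auto simp: std_normal_cdf_0)
  then have "1 - \<alpha> \<in> range std_normal_cdf"
    by (metis rangeI)
  moreover have "inj std_normal_cdf"
    using less by (intro strict_mono_imp_inj_on strict_monoI)
  ultimately show quantile: "std_normal_cdf (normal_quantile \<alpha>) = 1 - \<alpha>"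
    unfolding normal_quantile_def by (intro f_the_inv_into_f)
  show "0 < normal_quantile \<alpha>"
  proof (rule ccontr)
    assume "\<not> 0 < normal_quantile \<alpha>"
    then have "std_normal_cdf (normal_quantile \<alpha>) \<le> std_normal_cdf 0"
      by (intro N.cdf_nondecreasing) simp
    then show False
      using assms by (simp add: quantile std_normal_cdf_0)
  qed
qed

text \<open>The common interface of the two models. By \<open>repr\<close>, any finitely many
  coordinates of \<open>X\<close> and \<open>Y\<close> arise through the same map \<open>H\<close>
  from a standard normal vector and from its shift, so a cylinder event pulls back to an event of
  that vector. \<open>Gaussian_shift_bound\<close> then applies with constants independent of
  \<open>J\<close>, and \<open>PiM_power_bound\<close> passes from cylinders to
  \<open>A\<close>.\<close>

lemma (in prob_space) Gaussian_observation_bound: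
  fixes X Y :: "'a \<Rightarrow> 't \<Rightarrow> real"
  assumes X[measurable]: "X \<in> measurable M (\<Pi>\<^sub>M t\<in>T. borel)"
    and Y[measurable]: "Y \<in> measurable M (\<Pi>\<^sub>M t\<in>T. borel)"
    and A[measurable]: "A \<in> sets (\<Pi>\<^sub>M t\<in>T. borel)" and z: "0 \<le> z"
    and repr: "\<And>J. finite J \<Longrightarrow> J \<subseteq> T \<Longrightarrow> \<exists>(I :: 'i set) Z \<theta> H.
      finite I \<and> indep_vars (\<lambda>_. borel) Z I \<and>
      (\<forall>i\<in>I. distributed M lborel (Z i) std_normal_density) \<and>
      H \<in> measurable (\<Pi>\<^sub>M i\<in>I. borel) (\<Pi>\<^sub>M t\<in>J. borel) \<and>
      (\<Sum>i\<in>I. (\<theta> i)\<^sup>2) \<le> z\<^sup>2 \<and>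
      (\<forall>\<omega>\<in>space M. restrict (X \<omega>) J = H (\<lambda>i\<in>I. Z i \<omega>) \<and>
        restrict (Y \<omega>) J = H (\<lambda>i\<in>I. Z i \<omega> + \<theta> i))"
    and prob_Y: "std_normal_cdf z \<le> prob {\<omega> \<in> space M. Y \<omega> \<in> A}"
  shows "1 / 2 \<le> prob {\<omega> \<in> space M. X \<omega> \<in> A}"
proof -
  let ?B = "\<lambda>T. \<Pi>\<^sub>M t\<in>T. borel :: real measure"
  have measure_distr: "measure (distr M (?B T) V) C = prob {\<omega> \<in> space M. V \<omega> \<in> C}"
    if "V \<in> measurable M (?B T)" "C \<in> sets (?B T)" for V C
    using that by (subst measure_distr) (auto intro!: arg_cong[where f=prob])
  have "1 / 2 \<le> measure (distr M (?B T) X) A"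
  proof (rule PiM_power_bound[where Q="distr M (?B T) Y" and c="exp (- z\<^sup>2 / 2)"
        and q="std_normal_cdf z" and T=T])
    fix J B assume J: "finite J" "J \<subseteq> T" and B[measurable]: "B \<in> sets (?B J)"
    obtain I :: "'i set" and Z \<theta> H where I: "finite I" "indep_vars (\<lambda>_. borel) Z I"
      "\<And>i. i \<in> I \<Longrightarrow> distributed M lborel (Z i) std_normal_density"
      and H[measurable]: "H \<in> measurable (?B I) (?B J)"
      and \<theta>: "(\<Sum>i\<in>I. (\<theta> i)\<^sup>2) \<le> z\<^sup>2"
      and HX: "\<And>\<omega>. \<omega> \<in> space M \<Longrightarrow> restrict (X \<omega>) J = H (\<lambda>i\<in>I. Z i \<omega>)"
      and HY: "\<And>\<omega>. \<omega> \<in> space M \<Longrightarrow> restrict (Y \<omega>) J = H (\<lambda>i\<in>I. Z i \<omega> + \<theta> i)"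
      using repr[OF J] by blast
    let ?C = "prod_emb T (\<lambda>_. borel) J B"
    have C: "?C \<in> sets (?B T)"
      using J by (auto intro!: measurable_prod_emb)
    have XT: "X \<omega> \<in> space (?B T)" and YT: "Y \<omega> \<in> space (?B T)" if "\<omega> \<in> space M" for \<omega>
      using that by (auto intro!: measurable_space[OF X] measurable_space[OF Y])
    let ?D = "H -` B \<inter> space (?B I)"
    have D: "?D \<in> sets (?B I)"
      by measurable
    have "{\<omega> \<in> space M. X \<omega> \<in> ?C} = {\<omega> \<in> space M. (\<lambda>i\<in>I. Z i \<omega>) \<in> ?D}"
      using XT HX by (auto simp: prod_emb_def space_PiM)
    moreover have "{\<omega> \<in> space M. Y \<omega> \<in> ?C} = {\<omega> \<in> space M. (\<lambda>i\<in>I. Z i \<omega> + \<theta> i) \<in> ?D}"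
      using YT HY by (auto simp: prod_emb_def space_PiM)
    ultimately show "measure (distr M (?B T) Y) ?C - std_normal_cdf z \<le>
        max (measure (distr M (?B T) X) ?C - 1 / 2)
          (exp (- z\<^sup>2 / 2) * (measure (distr M (?B T) X) ?C - 1 / 2))"
      using Gaussian_shift_bound[OF I D \<theta> z] by (simp add: measure_distr[OF X C] measure_distr[OF Y C])
  qed (auto simp: measure_distr prob_Y intro: prob_space_distr)
  then show ?thesis
    by (simp add: measure_distr)
qed

text \<open>The two-point argument for an arbitrary family of laws: normality enters only through
  \<open>power\<close>, which is applied to the event that the interval covers
  \<open>T g\<close>.\<close>

lemma minimax_length_lower_bound:
  fixes P :: "('a \<Rightarrow> real) \<Rightarrow> 'y measure"
  assumes \<alpha>: "\<alpha> < 1 / 2" and F: "F1 \<subseteq> F"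
    and P: "\<And>f. f \<in> F \<Longrightarrow> prob_space (P f)" "\<And>f. f \<in> F \<Longrightarrow> sets (P f) = sets S"
    and power: "\<And>f g A. f \<in> F1 \<Longrightarrow> g \<in> F \<Longrightarrow> square_integrable \<mu> (\<lambda>x. g x - f x) \<Longrightarrow>
      L2_norm \<mu> (\<lambda>x. g x - f x) \<le> \<epsilon> \<Longrightarrow> A \<in> sets S \<Longrightarrow> 1 - \<alpha> \<le> measure (P g) A \<Longrightarrow>
      1 / 2 \<le> measure (P f) A"
  shows "ennreal (1 / 2 - \<alpha>) * between_class_modulus \<mu> T \<epsilon> F1 F \<le> minimax_length S P T \<alpha> F1 F"
  unfolding minimax_length_def
proof (rule INF_greatest)
  fix CI assume "CI \<in> confidence_intervals S P T \<alpha> F"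
  then have interval: "\<And>y. y \<in> space S \<Longrightarrow> is_interval (CI y)"
    and meas: "\<And>x. {y \<in> space S. x \<in> CI y} \<in> sets S"
    and INF: "1 - \<alpha> \<le> (INF f\<in>F. measure (P f) {y \<in> space S. T f \<in> CI y})"
    by (auto simp: confidence_intervals_def data_dependent_interval_def)
  \<comment> \<open>An infimum of reals is a lower bound only if the family is bounded below; for
    probabilities 0 is such a bound.\<close>
  have cover: "1 - \<alpha> \<le> measure (P f) {y \<in> space S. T f \<in> CI y}" if "f \<in> F" for f
    using that by (intro order_trans[OF INF cINF_lower] bdd_belowI2[where m=0]) auto
  have pair: "ennreal (1 / 2 - \<alpha>) * ennreal \<bar>T g - T f\<bar> \<le> max_expected_length P CI F1"
    if f: "f \<in> F1" and g: "g \<in> F" and fg: "square_integrable \<mu> (\<lambda>x. g x - f x)"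
      "L2_norm \<mu> (\<lambda>x. g x - f x) \<le> \<epsilon>" for f g
  proof -
    have "f \<in> F"
      using F f by auto
    interpret prob_space "P f"
      using P \<open>f \<in> F\<close> by blast
    have sets_P: "sets (P f) = sets S"
      using P \<open>f \<in> F\<close> by blast
    define Af where "Af = {y \<in> space S. T f \<in> CI y}"
    define Ag where "Ag = {y \<in> space S. T g \<in> CI y}"
    have A: "Af \<in> sets (P f)" "Ag \<in> sets (P f)"
      using meas by (simp_all add: Af_def Ag_def sets_P)
    have "1 / 2 \<le> prob Ag"
      using power[OF f g fg _ cover[OF g]] meas by (simp add: Ag_def)
    moreover have "1 - \<alpha> \<le> prob Af"
      using cover[OF \<open>f \<in> F\<close>] by (simp add: Af_def)
    moreover have "prob (Af \<union> Ag) = prob Af + prob (Ag - Af)"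
      "prob Ag = prob (Ag \<inter> Af) + prob (Ag - Af)"
      using finite_measure_Union'[OF A] finite_measure_Diff'[OF A(2,1)] by auto
    ultimately have *: "1 / 2 - \<alpha> \<le> prob (Ag \<inter> Af)"
      using prob_le_1[of "Af \<union> Ag"] by linarith
    have len: "ennreal \<bar>T g - T f\<bar> \<le> emeasure lborel (CI y)" if "y \<in> Ag \<inter> Af" for y
    proof -
      have y: "T f \<in> CI y" "T g \<in> CI y" "is_interval (CI y)"
        using that interval by (auto simp: Af_def Ag_def)
      then have "{min (T f) (T g)..max (T f) (T g)} \<subseteq> CI y"
        using mem_is_interval_1_I[OF y(3,1,2)] mem_is_interval_1_I[OF y(3,2,1)]
        by (auto simp: min_def max_def split: if_splits)
      moreover have "CI y \<in> sets lborel"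
        using y(3) by (simp add: real_interval_borel_measurable)
      ultimately have "emeasure lborel {min (T f) (T g)..max (T f) (T g)} \<le> emeasure lborel (CI y)"
        by (rule emeasure_mono)
      then show ?thesis
        by (simp add: min_def max_def abs_if split: if_splits)
    qed
    have "ennreal (1 / 2 - \<alpha>) * ennreal \<bar>T g - T f\<bar> \<le> ennreal \<bar>T g - T f\<bar> * emeasure (P f) (Ag \<inter> Af)"
      using * by (subst mult.commute) (auto simp: emeasure_eq_measure intro!: mult_left_mono ennreal_leI)
    also have "\<dots> = (\<integral>\<^sup>+y. ennreal \<bar>T g - T f\<bar> * indicator (Ag \<inter> Af) y \<partial>P f)"
      using A by (subst nn_integral_cmult_indicator) auto
    also have "\<dots> \<le> (\<integral>\<^sup>+y. emeasure lborel (CI y) \<partial>P f)"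
      using len by (intro nn_integral_mono) (auto simp: indicator_def)
    also have "\<dots> \<le> max_expected_length P CI F1"
      unfolding max_expected_length_def using f by (rule SUP_upper)
    finally show ?thesis .
  qed
  let ?X = "{ennreal \<bar>T g - T f\<bar> | f g. f \<in> F1 \<and> g \<in> F \<and>
       square_integrable \<mu> (\<lambda>x. g x - f x) \<and> L2_norm \<mu> (\<lambda>x. g x - f x) \<le> \<epsilon>}"
  \<comment> \<open>In \<open>ennreal\<close> a constant factor moves inside the supremum even when
    the modulus is infinite, so the bounds for single pairs suffice.\<close>
  have "ennreal (1 / 2 - \<alpha>) * Sup ?X = (SUP x\<in>?X. ennreal (1 / 2 - \<alpha>) * x)"
    using SUP_mult_left_ennreal[of "ennreal (1 / 2 - \<alpha>)" "\<lambda>x. x" ?X] by simp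
  also have "\<dots> \<le> max_expected_length P CI F1"
    using pair by (intro SUP_least) auto
  finally show "ennreal (1 / 2 - \<alpha>) * between_class_modulus \<mu> T \<epsilon> F1 F \<le> max_expected_length P CI F1"
    by (simp add: between_class_modulus_def)
qed

subsection \<open>Gaussian sequence model\<close>

lemma seq_observation_measurable:
  assumes "iid_std_normal M \<Omega> z"
  shows "seq_observation M z n f \<in> measurable \<Omega> (seq_data M)"
proof -
  have [measurable]: "z i \<in> borel_measurable \<Omega>" if "i \<in> M" for i
    using assms that distributed_measurable[of \<Omega> lborel "z i"] by (auto simp: iid_std_normal_def)
  show ?thesis
    unfolding seq_observation_def[abs_def] seq_data_def by measurable
qed

text \<open>Bounds the squared mean shift of finitely many coordinates by the full squared norm: the
  sum is the integral of \<open>h\<close> cut off outside \<open>J\<close>.\<close>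

lemma sum_le_integral_count_space:
  fixes h :: "'i \<Rightarrow> real"
  assumes "integrable (count_space M) h" "finite J" "J \<subseteq> M" "\<And>i. 0 \<le> h i"
  shows "sum h J \<le> (\<integral>i. h i \<partial>count_space M)"
proof -
  have "sum h J = (\<integral>i. indicator J i * h i \<partial>count_space M)"
    using assms(2,3) by (subst lebesgue_integral_count_space_finite_support)
      (auto simp: indicator_def intro!: sum.mono_neutral_cong_right elim: finite_subset[rotated])
  also have "\<dots> \<le> (\<integral>i. h i \<partial>count_space M)"
  proof (rule integral_mono)
    show "integrable (count_space M) (\<lambda>i. indicator J i * h i)"
      using integrable_real_mult_indicator[of J "count_space M" h] assms by (simp add: mult.commute)
  qed (use assms in \<open>auto simp: indicator_def\<close>)
  finally show ?thesis .
qed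

lemma seq_power:
  fixes M :: "'i set"
  assumes iid: "iid_std_normal M \<Omega> z" and n: "0 < n" and q: "0 \<le> q"
    and h: "square_integrable (count_space M) (\<lambda>i. g i - f i)"
      "L2_norm (count_space M) (\<lambda>i. g i - f i) \<le> q / sqrt n"
    and A: "A \<in> sets (seq_data M)"
    and g: "std_normal_cdf q \<le> measure (seq_law M \<Omega> z n g) A"
  shows "1 / 2 \<le> measure (seq_law M \<Omega> z n f) A"
proof -
  interpret prob_space \<Omega>
    using iid by (simp add: iid_std_normal_def)
  have law: "measure (seq_law M \<Omega> z n f) A = prob {\<omega> \<in> space \<Omega>. seq_observation M z n f \<omega> \<in> A}" for f
    unfolding seq_law_def using seq_observation_measurable[OF iid] A
    by (subst measure_distr) (auto intro!: arg_cong[where f=prob])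
  have "(L2_norm (count_space M) (\<lambda>i. g i - f i))\<^sup>2 \<le> (q / sqrt n)\<^sup>2"
    using h(2) by (rule power_mono) (simp add: L2_norm_def)
  then have int: "n * (\<integral>i. (g i - f i)\<^sup>2 \<partial>count_space M) \<le> q\<^sup>2"
    using n by (simp add: L2_norm_def power_divide field_simps)
  have "1 / 2 \<le> prob {\<omega> \<in> space \<Omega>. seq_observation M z n f \<omega> \<in> A}"
  proof (rule Gaussian_observation_bound[where Y="seq_observation M z n g" and z=q and T=M])
    fix J assume J: "finite J" "J \<subseteq> M"
    \<comment> \<open>The noise variables in \<open>J\<close> serve directly as the normal vector.
      \<open>H\<close> rescales them and adds \<open>f\<close>; shifting the noise by
      \<open>\<theta>\<close> replaces \<open>f\<close> by \<open>g\<close>.\<close>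
    define \<theta> where "\<theta> i = sqrt n * (g i - f i)" for i
    define H where "H x = (\<lambda>i\<in>J. f i + x i / sqrt n)" for x :: "'i \<Rightarrow> real"
    have "H \<in> measurable (\<Pi>\<^sub>M i\<in>J. borel) (\<Pi>\<^sub>M i\<in>J. borel)"
      unfolding H_def[abs_def] by measurable
    moreover have "indep_vars (\<lambda>_. borel) z J" "\<forall>i\<in>J. distributed \<Omega> lborel (z i) std_normal_density"
      using iid J by (auto simp: iid_std_normal_def intro: indep_vars_subset)
    moreover have "(\<Sum>i\<in>J. (\<theta> i)\<^sup>2) = n * (\<Sum>i\<in>J. (g i - f i)\<^sup>2)"
      using n by (simp add: \<theta>_def power_mult_distrib sum_distrib_left)
    then have "(\<Sum>i\<in>J. (\<theta> i)\<^sup>2) \<le> q\<^sup>2"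
      using sum_le_integral_count_space[OF _ J, of "\<lambda>i. (g i - f i)\<^sup>2"] h(1) n
      by (intro order_trans[OF _ int]) (simp add: square_integrable_def)
    moreover have "restrict (seq_observation M z n f \<omega>) J = H (\<lambda>i\<in>J. z i \<omega>)"
      "restrict (seq_observation M z n g \<omega>) J = H (\<lambda>i\<in>J. z i \<omega> + \<theta> i)" for \<omega>
      using J n by (auto simp: seq_observation_def H_def \<theta>_def add_divide_distrib fun_eq_iff restrict_def)
    ultimately show "\<exists>(I :: 'i set) Z \<theta> H.
      finite I \<and> indep_vars (\<lambda>_. borel) Z I \<and>
      (\<forall>i\<in>I. distributed \<Omega> lborel (Z i) std_normal_density) \<and>
      H \<in> measurable (\<Pi>\<^sub>M i\<in>I. borel) (\<Pi>\<^sub>M t\<in>J. borel) \<and>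
      (\<Sum>i\<in>I. (\<theta> i)\<^sup>2) \<le> q\<^sup>2 \<and>
      (\<forall>\<omega>\<in>space \<Omega>. restrict (seq_observation M z n f \<omega>) J = H (\<lambda>i\<in>I. Z i \<omega>) \<and>
        restrict (seq_observation M z n g \<omega>) J = H (\<lambda>i\<in>I. Z i \<omega> + \<theta> i))"
      using J(1) by (intro exI[of _ J] exI[of _ z] exI[of _ \<theta>] exI[of _ H]) simp
  qed (use seq_observation_measurable[OF iid] A q g in \<open>auto simp: law seq_data_def\<close>)
  then show ?thesis
    by (simp add: law)
qed

subsection \<open>White noise model\<close>

text \<open>The integral of \<open>(h x - c)^2\<close> is nonnegative; expanding it with
  \<open>c\<close> the mean of \<open>h\<close> on the interval gives the inequality.\<close>

lemma Cauchy_Schwarz_interval: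
  fixes h :: "real \<Rightarrow> real"
  assumes "a < b" and h: "h integrable_on {a..b}" "(\<lambda>x. (h x)\<^sup>2) integrable_on {a..b}"
  shows "(integral {a..b} h)\<^sup>2 \<le> (b - a) * integral {a..b} (\<lambda>x. (h x)\<^sup>2)"
proof -
  define c where "c = integral {a..b} h / (b - a)"
  have "((\<lambda>x. (h x)\<^sup>2 - (2 * c) * h x + c\<^sup>2) has_integral
      (integral {a..b} (\<lambda>x. (h x)\<^sup>2) - (2 * c) * integral {a..b} h + (b - a) * c\<^sup>2)) {a..b}"
    using has_integral_const_real[of "c\<^sup>2" a b] \<open>a < b\<close> h
    by (intro has_integral_add has_integral_diff has_integral_mult_right) (auto simp: integrable_integral)
  moreover have "(h x)\<^sup>2 - (2 * c) * h x + c\<^sup>2 = (h x - c)\<^sup>2" for x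
    by (simp add: power2_diff)
  ultimately have "0 \<le> integral {a..b} (\<lambda>x. (h x)\<^sup>2) - (2 * c) * integral {a..b} h + (b - a) * c\<^sup>2"
    by (auto intro: has_integral_nonneg)
  also have "(b - a) * c\<^sup>2 = c * integral {a..b} h"
    using \<open>a < b\<close> by (simp add: c_def power2_eq_square)
  also have "integral {a..b} (\<lambda>x. (h x)\<^sup>2) - (2 * c) * integral {a..b} h + c * integral {a..b} h =
      integral {a..b} (\<lambda>x. (h x)\<^sup>2) - (integral {a..b} h)\<^sup>2 / (b - a)"
    by (simp add: c_def power2_eq_square)
  finally show ?thesis
    using \<open>a < b\<close> by (simp add: field_simps)
qed

lemma integrable_lebesgue_on_Icc_subset:
  fixes h :: "real \<Rightarrow> real"
  assumes "integrable (lebesgue_on {a..b}) h" "a \<le> s" "t \<le> b"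
  shows "integrable (lebesgue_on {s..t}) h"
proof -
  have "set_integrable lebesgue {a..b} h"
    using assms(1) by (simp add: set_integrable_def integrable_restrict_space)
  then have "set_integrable lebesgue {s..t} h"
    by (rule set_integrable_subset) (use assms(2,3) in auto)
  then show ?thesis
    by (rule absolutely_integrable_imp_integrable) simp
qed

text \<open>Connects the Lebesgue integrals in the drift of the observation with gauge integrals,
  which combine over adjacent intervals.\<close>

lemma integral_lebesgue_on_diff:
  fixes h :: "real \<Rightarrow> real"
  assumes h: "integrable (lebesgue_on {a..b}) h" and st: "a \<le> s" "s \<le> t" "t \<le> b"
  shows "(\<integral>x. h x \<partial>lebesgue_on {a..t}) - (\<integral>x. h x \<partial>lebesgue_on {a..s}) = integral {s..t} h"
proof -
  have int: "integrable (lebesgue_on {a..u}) h" if "u \<le> b" for u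
    using h that by (intro integrable_lebesgue_on_Icc_subset[OF h]) auto
  have "integral {a..s} h + integral {s..t} h = integral {a..t} h"
    using st int by (intro Henstock_Kurzweil_Integration.integral_combine integrable_on_lebesgue_on) auto
  then show ?thesis
    using st int by (simp add: lebesgue_integral_eq_integral)
qed

text \<open>Cauchy-Schwarz on each piece bounds the summand by the integral of \<open>h^2\<close>
  over that piece, and these integrals telescope. Up to the factor \<open>n\<close>, the left side
  is the squared norm of the mean shift of the standardized increments.\<close>

lemma integral_square_increments:
  fixes h :: "real \<Rightarrow> real"
  assumes h: "integrable (lebesgue_on {a..b}) h" "integrable (lebesgue_on {a..b}) (\<lambda>x. (h x)\<^sup>2)"
    and \<tau>: "\<And>i. i \<le> k \<Longrightarrow> \<tau> i \<in> {a..b}" "\<And>i. i < k \<Longrightarrow> \<tau> i < \<tau> (Suc i)"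
  shows "(\<Sum>i<k. (integral {\<tau> i..\<tau> (Suc i)} h)\<^sup>2 / (\<tau> (Suc i) - \<tau> i)) \<le> (\<integral>x. (h x)\<^sup>2 \<partial>lebesgue_on {a..b})"
proof -
  define G where "G t = (\<integral>x. (h x)\<^sup>2 \<partial>lebesgue_on {a..t})" for t
  have int: "h integrable_on {s..t}" "(\<lambda>x. (h x)\<^sup>2) integrable_on {s..t}" if "a \<le> s" "t \<le> b" for s t
    using h[THEN integrable_lebesgue_on_Icc_subset, OF that] by (auto intro: integrable_on_lebesgue_on)
  have "(integral {\<tau> i..\<tau> (Suc i)} h)\<^sup>2 / (\<tau> (Suc i) - \<tau> i) \<le> G (\<tau> (Suc i)) - G (\<tau> i)" if "i < k" for i
  proof -
    have i: "a \<le> \<tau> i" "\<tau> i < \<tau> (Suc i)" "\<tau> (Suc i) \<le> b"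
      using \<tau>(1)[of i] \<tau>(1)[of "Suc i"] \<tau>(2)[of i] that by auto
    have "(integral {\<tau> i..\<tau> (Suc i)} h)\<^sup>2 \<le>
        (\<tau> (Suc i) - \<tau> i) * integral {\<tau> i..\<tau> (Suc i)} (\<lambda>x. (h x)\<^sup>2)"
      using i by (intro Cauchy_Schwarz_interval int) auto
    also have "integral {\<tau> i..\<tau> (Suc i)} (\<lambda>x. (h x)\<^sup>2) = G (\<tau> (Suc i)) - G (\<tau> i)"
      unfolding G_def using i h by (intro integral_lebesgue_on_diff[symmetric]) auto
    finally show ?thesis
      using i by (simp add: field_simps)
  qed
  then have "(\<Sum>i<k. (integral {\<tau> i..\<tau> (Suc i)} h)\<^sup>2 / (\<tau> (Suc i) - \<tau> i)) \<le> (\<Sum>i<k. G (\<tau> (Suc i)) - G (\<tau> i))"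
    by (intro sum_mono) auto
  also have "\<dots> = G (\<tau> k) - G (\<tau> 0)"
    by (rule sum_lessThan_telescope)
  \<comment> \<open>The points need not exhaust \<open>{a..b}\<close>; the pieces before
    \<open>\<tau> 0\<close> and after \<open>\<tau> k\<close> only add nonnegative amounts.\<close>
  also have "\<dots> \<le> G b"
  proof -
    have "G b - G (\<tau> k) = integral {\<tau> k..b} (\<lambda>x. (h x)\<^sup>2)"
      unfolding G_def using \<tau>(1)[of k] h by (intro integral_lebesgue_on_diff) auto
    moreover have "0 \<le> integral {\<tau> k..b} (\<lambda>x. (h x)\<^sup>2)"
      using \<tau>(1)[of k] by (intro Henstock_Kurzweil_Integration.integral_nonneg int) auto
    moreover have "0 \<le> G (\<tau> 0)"
      by (simp add: G_def)
    ultimately show ?thesis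
      by simp
  qed
  finally show ?thesis
    by (simp add: G_def)
qed

text \<open>The observation times become endpoints of increments. Adding \<open>a\<close>, where
  Brownian motion starts at 0, lets the path at each of these times be recovered by summing
  increments.\<close>

lemma finite_set_partition:
  fixes J :: "real set"
  assumes "finite J" "J \<subseteq> {a..b}" "a \<le> b"
  obtains k :: nat and \<tau> :: "nat \<Rightarrow> real"
  where "\<tau> 0 = a" "\<And>i. i \<le> k \<Longrightarrow> \<tau> i \<in> {a..b}" "\<And>i. i < k \<Longrightarrow> \<tau> i < \<tau> (Suc i)" "J \<subseteq> \<tau> ` {..k}"
proof -
  define xs where "xs = sorted_list_of_set (insert a J)"
  define k where "k = length xs - 1"
  have set_xs: "set xs = insert a J"
    using assms by (simp add: xs_def del: sorted_list_of_set_insert_remove)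
  then have "xs \<noteq> []"
    by auto
  then have k: "length xs = Suc k"
    by (simp add: k_def)
  have sorted: "sorted_wrt (<) xs"
    by (simp add: xs_def strict_sorted_iff)
  show ?thesis
  proof (rule that)
    show mem: "xs ! i \<in> {a..b}" if "i \<le> k" for i
      using that k set_xs nth_mem[of i xs] assms by auto
    \<comment> \<open>This position must be 0, since in a strictly increasing list the entries
      before it would be smaller than \<open>a\<close>.\<close>
    obtain i where i: "i \<le> k" "xs ! i = a"
      using set_xs k by (metis in_set_conv_nth insertI1 less_Suc_eq_le)
    show "xs ! 0 = a"
      using sorted_wrt_nth_less[OF sorted, of 0 i] i k mem[of 0] by (cases i) auto
    show "xs ! i < xs ! Suc i" if "i < k" for i
      using sorted_wrt_nth_less[OF sorted, of i "Suc i"] that k by simp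
    show "J \<subseteq> (!) xs ` {..k}"
      using set_xs k by (auto simp: in_set_conv_nth image_def less_Suc_eq_le) (metis atMost_iff in_set_conv_nth insertCI less_Suc_eq_le)
  qed
qed

section \<open>The observed path and its increments\<close>

text \<open>Measurability holds coordinate by coordinate. Paths stay among the continuous functions
  because the drift is an indefinite integral of an integrable function.\<close>

lemma wn_observation_measurable:
  assumes W: "brownian_motion_on (-1/2) (1/2) \<Omega> W" and f: "f \<in> wn_signals"
  shows "wn_observation W n f \<in> measurable \<Omega> wn_data"
  unfolding wn_data_def
proof (rule measurable_restrict_space2)
  have "W t \<in> borel_measurable \<Omega>" if "t \<in> wn_interval" for t
    using W that by (auto simp: brownian_motion_on_def wn_interval_def)
  then show "wn_observation W n f \<in> measurable \<Omega> (\<Pi>\<^sub>M t\<in>wn_interval. borel)"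
    unfolding wn_observation_def[abs_def] by measurable
  have "integrable (lebesgue_on {-1/2..1/2}) f"
    using f by (simp add: wn_signals_def wn_interval_def)
  then have "continuous_on {-1/2..1/2} (\<lambda>t. \<integral>s. f s \<partial>lebesgue_on {-1/2..t})"
    by (rule indefinite_integral_continuous_real)
  moreover have "continuous_on {-1/2..1/2} (\<lambda>t. W t \<omega>)" if "\<omega> \<in> space \<Omega>" for \<omega>
    using W that by (simp add: brownian_motion_on_def)
  ultimately have "continuous_on {-1/2..1/2} (\<lambda>t. (\<integral>s. f s \<partial>lebesgue_on {-1/2..t}) + W t \<omega> / sqrt n)"
    if "\<omega> \<in> space \<Omega>" for \<omega>
    \<comment> \<open>For \<open>sqrt n = 0\<close> the quotient is the constant 0 by
      convention.\<close>
    using that by (cases "sqrt n = 0") (auto intro!: continuous_intros)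
  moreover have "continuous_on {-1/2..1/2} (wn_observation W n f \<omega>) \<longleftrightarrow>
      continuous_on {-1/2..1/2} (\<lambda>t. (\<integral>s. f s \<partial>lebesgue_on {-1/2..t}) + W t \<omega> / sqrt n)" for \<omega>
    by (intro continuous_on_cong) (auto simp: wn_observation_def wn_interval_def)
  ultimately show "wn_observation W n f \<in> space \<Omega> \<rightarrow> {y. continuous_on wn_interval y}"
    by (simp add: wn_interval_def)
qed

text \<open>The normal vector consists of the standardized increments of \<open>W\<close> over a
  partition through the finitely many times in \<open>J\<close>; partial sums recover the path at
  these times.\<close>

lemma wn_power:
  assumes W: "brownian_motion_on (-1/2) (1/2) \<Omega> W" and n: "0 < n" and q: "0 \<le> q"
    and fg: "f \<in> wn_signals" "g \<in> wn_signals"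
    and h: "square_integrable (lebesgue_on wn_interval) (\<lambda>t. g t - f t)"
      "L2_norm (lebesgue_on wn_interval) (\<lambda>t. g t - f t) \<le> q / sqrt n"
    and A: "A \<in> sets wn_data"
    and g: "std_normal_cdf q \<le> measure (wn_law \<Omega> W n g) A"
  shows "1 / 2 \<le> measure (wn_law \<Omega> W n f) A"
proof -
  interpret prob_space \<Omega>
    using W by (simp add: brownian_motion_on_def)
  let ?a = "-1/2 :: real" and ?b = "1/2 :: real"
  have law: "measure (wn_law \<Omega> W n u) A = prob {\<omega> \<in> space \<Omega>. wn_observation W n u \<omega> \<in> A}"
    if "u \<in> wn_signals" for u
    unfolding wn_law_def using wn_observation_measurable[OF W that] A
    by (subst measure_distr) (auto intro!: arg_cong[where f=prob])
  \<comment> \<open>Cylinder approximation works in the full product space. Observed paths are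
    continuous, so \<open>A\<close> and \<open>A'\<close> describe the same event of the
    observation.\<close>
  obtain A' where A': "A' \<in> sets (\<Pi>\<^sub>M t\<in>wn_interval. borel)" "A = {y. continuous_on wn_interval y} \<inter> A'"
    using A by (auto simp: wn_data_def sets_restrict_space)
  have obs_A': "wn_observation W n u \<omega> \<in> A \<longleftrightarrow> wn_observation W n u \<omega> \<in> A'"
    if "u \<in> wn_signals" "\<omega> \<in> space \<Omega>" for u \<omega>
    using measurable_space[OF wn_observation_measurable[OF W that(1)] that(2), of n]
    by (simp add: A' wn_data_def space_restrict_space)
  have law': "measure (wn_law \<Omega> W n u) A = prob {\<omega> \<in> space \<Omega>. wn_observation W n u \<omega> \<in> A'}"
    if "u \<in> wn_signals" for u
    unfolding law[OF that] using obs_A'[OF that] by (intro arg_cong[where f=prob]) blast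
  have obs_PiM: "wn_observation W n u \<in> measurable \<Omega> (\<Pi>\<^sub>M t\<in>wn_interval. borel)" if "u \<in> wn_signals" for u
    using wn_observation_measurable[OF W that, of n]
    by (auto simp: wn_data_def measurable_restrict_space2_iff)
  have int_fg: "integrable (lebesgue_on {?a..?b}) f" "integrable (lebesgue_on {?a..?b}) g"
    using fg by (auto simp: wn_signals_def wn_interval_def)
  then have int_h: "integrable (lebesgue_on {?a..?b}) (\<lambda>t. g t - f t)"
    by auto
  have int_h2: "integrable (lebesgue_on {?a..?b}) (\<lambda>t. (g t - f t)\<^sup>2)"
    using h(1) by (simp add: square_integrable_def wn_interval_def)
  have "(L2_norm (lebesgue_on wn_interval) (\<lambda>t. g t - f t))\<^sup>2 \<le> (q / sqrt n)\<^sup>2"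
    using h(2) by (rule power_mono) (simp add: L2_norm_def)
  then have norm: "n * (\<integral>t. (g t - f t)\<^sup>2 \<partial>lebesgue_on {?a..?b}) \<le> q\<^sup>2"
    using n by (simp add: L2_norm_def power_divide field_simps wn_interval_def)
  have "1 / 2 \<le> prob {\<omega> \<in> space \<Omega>. wn_observation W n f \<omega> \<in> A'}"
  proof (rule Gaussian_observation_bound[where Y="wn_observation W n g" and z=q and T=wn_interval])
    fix J assume J: "finite J" "J \<subseteq> wn_interval"
    obtain k \<tau> where \<tau>: "\<tau> 0 = ?a" "\<And>i. i \<le> k \<Longrightarrow> \<tau> i \<in> {?a..?b}" "\<And>i. i < k \<Longrightarrow> \<tau> i < \<tau> (Suc i)"
      "J \<subseteq> \<tau> ` {..k}"
      by (rule finite_set_partition[of J ?a ?b]) (use J in \<open>auto simp: wn_interval_def\<close>)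
    have "\<forall>t\<in>J. \<exists>i. i \<le> k \<and> \<tau> i = t"
      using \<tau>(4) by blast
    then obtain m where m: "\<And>t. t \<in> J \<Longrightarrow> m t \<le> k \<and> \<tau> (m t) = t"
      unfolding bchoice_iff by blast
    define \<Delta> where "\<Delta> i = \<tau> (Suc i) - \<tau> i" for i
    have \<Delta>: "\<Delta> i > 0" if "i < k" for i
      using \<tau>(3)[OF that] by (simp add: \<Delta>_def)
    define D where "D i \<omega> = W (\<tau> (Suc i)) \<omega> - W (\<tau> i) \<omega>" for i \<omega>
    define Z where "Z i \<omega> = D i \<omega> / sqrt (\<Delta> i)" for i \<omega>
    \<comment> \<open>The difference of the two drifts over the piece, divided by
      \<open>sqrt (\<Delta> i) / sqrt n\<close>, the standard deviation of the noise there.\<close>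
    define \<theta> where "\<theta> i = sqrt n * integral {\<tau> i..\<tau> (Suc i)} (\<lambda>t. g t - f t) / sqrt (\<Delta> i)" for i
    define H where "H x = (\<lambda>t\<in>J. (\<integral>s. f s \<partial>lebesgue_on {?a..t}) + (\<Sum>i<m t. sqrt (\<Delta> i) * x i / sqrt n))"
      for x :: "nat \<Rightarrow> real"
    have "indep_vars (\<lambda>_. borel) D {..<k}"
      using W \<tau> by (simp add: brownian_motion_on_def D_def[abs_def])
    then have indep: "indep_vars (\<lambda>_. borel) Z {..<k}"
      unfolding Z_def[abs_def] by (rule indep_vars_compose2) auto
    have normal: "distributed \<Omega> lborel (Z i) std_normal_density" if "i \<in> {..<k}" for i
    proof -
      have "?a \<le> \<tau> i" "\<tau> i < \<tau> (Suc i)" "\<tau> (Suc i) \<le> ?b"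
        using \<tau>(2)[of i] \<tau>(2)[of "Suc i"] \<tau>(3)[of i] that by auto
      then have "distributed \<Omega> lborel (D i) (normal_density 0 (sqrt (\<Delta> i)))"
        using W unfolding brownian_motion_on_def D_def[abs_def] \<Delta>_def by blast
      then show ?thesis
        using normal_standard_normal_convert[of "sqrt (\<Delta> i)" "D i" 0] \<Delta>[of i] that
        by (simp add: Z_def[abs_def])
    qed
    have H: "H \<in> measurable (\<Pi>\<^sub>M i\<in>{..<k}. borel) (\<Pi>\<^sub>M t\<in>J. borel)"
      unfolding H_def[abs_def]
    proof (rule measurable_restrict)
      fix t assume t: "t \<in> J"
      \<comment> \<open>Only coordinates below \<open>k\<close> are measurable projections;
        \<open>m t \<le> k\<close> ensures that the sum uses no others.\<close>
      have "(\<lambda>x. x i) \<in> borel_measurable (\<Pi>\<^sub>M i\<in>{..<k}. borel)" if "i < m t" for i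
        using m[OF t] that by (intro measurable_component_singleton) auto
      then show "(\<lambda>x. (\<integral>s. f s \<partial>lebesgue_on {?a..t}) + (\<Sum>i<m t. sqrt (\<Delta> i) * x i / sqrt n))
          \<in> borel_measurable (\<Pi>\<^sub>M i\<in>{..<k}. borel)"
        by (intro borel_measurable_add borel_measurable_sum borel_measurable_divide
            borel_measurable_times) auto
    qed
    have "(\<Sum>i<k. (\<theta> i)\<^sup>2) = n * (\<Sum>i<k. (integral {\<tau> i..\<tau> (Suc i)} (\<lambda>t. g t - f t))\<^sup>2 / \<Delta> i)"
      using n \<Delta> by (simp add: \<theta>_def power_mult_distrib power_divide sum_distrib_left less_imp_le)
    also have "\<dots> \<le> n * (\<integral>t. (g t - f t)\<^sup>2 \<partial>lebesgue_on {?a..?b})"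
      unfolding \<Delta>_def using n \<tau> by (intro mult_left_mono integral_square_increments int_h int_h2) auto
    finally have \<theta>: "(\<Sum>i<k. (\<theta> i)\<^sup>2) \<le> q\<^sup>2"
      using norm by simp
    have W_sum: "(\<Sum>i<m t. sqrt (\<Delta> i) * Z i \<omega>) = W t \<omega>" if "t \<in> J" "\<omega> \<in> space \<Omega>" for t \<omega>
    proof -
      have "sqrt (\<Delta> i) * Z i \<omega> = D i \<omega>" if "i < m t" for i
        using m[OF \<open>t \<in> J\<close>] \<Delta>[of i] that by (simp add: Z_def)
      then have "(\<Sum>i<m t. sqrt (\<Delta> i) * Z i \<omega>) = (\<Sum>i<m t. D i \<omega>)"
        by simp
      also have "\<dots> = W (\<tau> (m t)) \<omega> - W (\<tau> 0) \<omega>"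
        unfolding D_def by (rule sum_lessThan_telescope)
      finally show ?thesis
        using m[OF that(1)] W that(2) \<tau>(1) by (simp add: brownian_motion_on_def)
    qed
    have \<theta>_sum: "(\<Sum>i<m t. sqrt (\<Delta> i) * \<theta> i / sqrt n) =
        (\<integral>s. g s \<partial>lebesgue_on {?a..t}) - (\<integral>s. f s \<partial>lebesgue_on {?a..t})" if "t \<in> J" for t
    proof -
      let ?G = "\<lambda>t. \<integral>s. g s - f s \<partial>lebesgue_on {?a..t}"
      have "sqrt (\<Delta> i) * \<theta> i / sqrt n = ?G (\<tau> (Suc i)) - ?G (\<tau> i)" if "i < m t" for i
      proof -
        have "i < k"
          using that m[OF \<open>t \<in> J\<close>] by simp
        then have "?G (\<tau> (Suc i)) - ?G (\<tau> i) = integral {\<tau> i..\<tau> (Suc i)} (\<lambda>t. g t - f t)"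
          using \<tau>(2)[of i] \<tau>(2)[of "Suc i"] \<tau>(3)[of i] by (intro integral_lebesgue_on_diff[OF int_h]) auto
        then show ?thesis
          using \<Delta>[OF \<open>i < k\<close>] n by (simp add: \<theta>_def)
      qed
      then have "(\<Sum>i<m t. sqrt (\<Delta> i) * \<theta> i / sqrt n) = (\<Sum>i<m t. ?G (\<tau> (Suc i)) - ?G (\<tau> i))"
        by (intro sum.cong) auto
      also have "\<dots> = ?G (\<tau> (m t)) - ?G (\<tau> 0)"
        by (rule sum_lessThan_telescope)
      also have "?G (\<tau> 0) = 0"
        using lebesgue_integral_eq_integral[OF integrable_lebesgue_on_Icc_subset[OF int_h, of ?a ?a]] \<tau>(1)
        by simp
      also have "?G (\<tau> (m t)) = (\<integral>s. g s \<partial>lebesgue_on {?a..t}) - (\<integral>s. f s \<partial>lebesgue_on {?a..t})"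
        using m[OF that] \<tau>(2)[of "m t"] by (subst Bochner_Integration.integral_diff)
          (auto intro!: integrable_lebesgue_on_Icc_subset[OF int_fg(1)] integrable_lebesgue_on_Icc_subset[OF int_fg(2)])
      finally show ?thesis
        by simp
    qed
    have "restrict (wn_observation W n f \<omega>) J = H (\<lambda>i\<in>{..<k}. Z i \<omega>)" (is ?f)
      and "restrict (wn_observation W n g \<omega>) J = H (\<lambda>i\<in>{..<k}. Z i \<omega> + \<theta> i)" (is ?g)
      if \<omega>: "\<omega> \<in> space \<Omega>" for \<omega>
    proof -
      have lt: "i < k" if "i < m t" "t \<in> J" for i t
        using m[OF that(2)] that(1) by simp
      have H_eq: "H (\<lambda>i\<in>{..<k}. x i) t =
          (\<integral>s. f s \<partial>lebesgue_on {?a..t}) + (\<Sum>i<m t. sqrt (\<Delta> i) * x i) / sqrt n" if "t \<in> J" for x t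
        using that lt by (auto simp: H_def sum_divide_distrib intro!: sum.cong)
      \<comment> \<open>Functions restricted to \<open>J\<close> are \<open>undefined\<close>
        elsewhere, so equality of functions also has to be checked there.\<close>
      have H_ext: "H x t = undefined" if "t \<notin> J" for x t
        using that by (simp add: H_def)
      show ?f
      proof
        fix t show "restrict (wn_observation W n f \<omega>) J t = H (\<lambda>i\<in>{..<k}. Z i \<omega>) t"
          using J(2) \<omega> by (cases "t \<in> J") (auto simp: H_eq H_ext W_sum wn_observation_def)
      qed
      show ?g
      proof
        fix t show "restrict (wn_observation W n g \<omega>) J t = H (\<lambda>i\<in>{..<k}. Z i \<omega> + \<theta> i) t"
        proof (cases "t \<in> J")
          case True
          have "(\<Sum>i<m t. sqrt (\<Delta> i) * (Z i \<omega> + \<theta> i)) / sqrt n =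
              W t \<omega> / sqrt n + (\<Sum>i<m t. sqrt (\<Delta> i) * \<theta> i / sqrt n)"
            by (simp add: distrib_left sum.distrib W_sum[OF True \<omega>] add_divide_distrib sum_divide_distrib)
          then show ?thesis
            using True J(2) by (auto simp: H_eq \<theta>_sum wn_observation_def)
        qed (simp add: H_ext)
      qed
    qed
    with indep normal H \<theta> show "\<exists>(I :: nat set) Z \<theta> H.
      finite I \<and> indep_vars (\<lambda>_. borel) Z I \<and>
      (\<forall>i\<in>I. distributed \<Omega> lborel (Z i) std_normal_density) \<and>
      H \<in> measurable (\<Pi>\<^sub>M i\<in>I. borel) (\<Pi>\<^sub>M t\<in>J. borel) \<and>
      (\<Sum>i\<in>I. (\<theta> i)\<^sup>2) \<le> q\<^sup>2 \<and>
      (\<forall>\<omega>\<in>space \<Omega>. restrict (wn_observation W n f \<omega>) J = H (\<lambda>i\<in>I. Z i \<omega>) \<and>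
        restrict (wn_observation W n g \<omega>) J = H (\<lambda>i\<in>I. Z i \<omega> + \<theta> i))"
      by (intro exI[of _ "{..<k}"] exI[of _ Z] exI[of _ \<theta>] exI[of _ H]) simp
  qed (use obs_PiM[OF fg(1)] obs_PiM[OF fg(2)] A'(1) q g in \<open>simp_all add: law'[OF fg(2)]\<close>)
  then show ?thesis
    by (simp only: law'[OF fg(1)])
qed

section \<open>The lower bound in both models\<close>

theorem theorem1:
  fixes \<alpha> n :: real
  assumes "0 < \<alpha>" "\<alpha> < 1/2" "0 < n"
  shows
    "(\<forall>(\<Omega> :: 'w measure) W V T F1 F.
        brownian_motion_on (-1/2) (1/2) \<Omega> W \<longrightarrow>
        linear_functional_on V T \<longrightarrow> V \<subseteq> wn_signals \<longrightarrow> F \<subseteq> V \<longrightarrow>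
        F1 \<subseteq> F \<longrightarrow> F1 \<noteq> {} \<longrightarrow>
        minimax_length wn_data (wn_law \<Omega> W n) T \<alpha> F1 F
          \<ge> ennreal (1/2 - \<alpha>) *
             between_class_modulus (lebesgue_on wn_interval) T (normal_quantile \<alpha> / sqrt n) F1 F)
     \<and>
     (\<forall>(M :: 'i set) (\<Omega> :: 'v measure) z V T F1 F.
        countable M \<longrightarrow> iid_std_normal M \<Omega> z \<longrightarrow>
        linear_functional_on V T \<longrightarrow> V \<subseteq> seq_signals M \<longrightarrow> F \<subseteq> V \<longrightarrow>
        F1 \<subseteq> F \<longrightarrow> F1 \<noteq> {} \<longrightarrow>
        minimax_length (seq_data M) (seq_law M \<Omega> z n) T \<alpha> F1 F
          \<ge> ennreal (1/2 - \<alpha>) *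
             between_class_modulus (count_space M) T (normal_quantile \<alpha> / sqrt n) F1 F)"
proof -
  \<comment> \<open>With \<open>q = normal_quantile \<alpha>\<close>, the premise
    \<open>std_normal_cdf q \<le> ...\<close> of \<open>wn_power\<close> and
    \<open>seq_power\<close> becomes the coverage level \<open>1 - \<alpha>\<close>; positivity
    supplies \<open>0 \<le> q\<close>.\<close>
  note quantile = std_normal_cdf_quantile[OF assms(1,2)] normal_quantile_pos[OF assms(1,2)]
  show ?thesis
  proof (intro conjI allI impI)
    fix \<Omega> :: "'w measure" and W V T and F1 F :: "(real \<Rightarrow> real) set"
    assume W: "brownian_motion_on (-1/2) (1/2) \<Omega> W" and V: "V \<subseteq> wn_signals" "F \<subseteq> V" "F1 \<subseteq> F"
    then have F: "f \<in> wn_signals" if "f \<in> F" for f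
      using that by auto
    show "ennreal (1/2 - \<alpha>) *
        between_class_modulus (lebesgue_on wn_interval) T (normal_quantile \<alpha> / sqrt n) F1 F
      \<le> minimax_length wn_data (wn_law \<Omega> W n) T \<alpha> F1 F"
    proof (rule minimax_length_lower_bound[OF assms(2) V(3)])
      show "prob_space (wn_law \<Omega> W n f)" if "f \<in> F" for f
        unfolding wn_law_def using W wn_observation_measurable[OF W F[OF that]]
        by (intro prob_space.prob_space_distr) (auto simp: brownian_motion_on_def)
      show "1 / 2 \<le> measure (wn_law \<Omega> W n f) A"
        if "f \<in> F1" "g \<in> F" "square_integrable (lebesgue_on wn_interval) (\<lambda>x. g x - f x)"
          "L2_norm (lebesgue_on wn_interval) (\<lambda>x. g x - f x) \<le> normal_quantile \<alpha> / sqrt n"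
          "A \<in> sets wn_data" "1 - \<alpha> \<le> measure (wn_law \<Omega> W n g) A" for f g A
        using that V(3) quantile
        by (intro wn_power[OF W assms(3) _ F F that(3,4,5)]) auto
    qed (simp add: wn_law_def)
  next
    fix M :: "'i set" and \<Omega> :: "'v measure" and z V T and F1 F :: "('i \<Rightarrow> real) set"
    assume iid: "iid_std_normal M \<Omega> z" and V: "F1 \<subseteq> F"
    show "ennreal (1/2 - \<alpha>) *
        between_class_modulus (count_space M) T (normal_quantile \<alpha> / sqrt n) F1 F
      \<le> minimax_length (seq_data M) (seq_law M \<Omega> z n) T \<alpha> F1 F"
    proof (rule minimax_length_lower_bound[OF assms(2) V])
      show "prob_space (seq_law M \<Omega> z n f)" for f
        unfolding seq_law_def using iid seq_observation_measurable[OF iid]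
        by (intro prob_space.prob_space_distr) (auto simp: iid_std_normal_def)
      show "1 / 2 \<le> measure (seq_law M \<Omega> z n f) A"
        if "square_integrable (count_space M) (\<lambda>x. g x - f x)"
          "L2_norm (count_space M) (\<lambda>x. g x - f x) \<le> normal_quantile \<alpha> / sqrt n"
          "A \<in> sets (seq_data M)" "1 - \<alpha> \<le> measure (seq_law M \<Omega> z n g) A" for f g A
        using that quantile by (intro seq_power[OF iid assms(3) _ that(1,2,3)]) auto
    qed (simp add: seq_law_def)
  qed
qed

end
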